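(* Let $r\ge 1$. For every integer $N\ge 3$ let $\mu_N$ be the probability measure on $[0,1]$ with density $f_N(u)=g(\{(N-1)u\})$, $u\in[0,1]$, where $g=c_r\varpi_r$; this density is continuous on $[0,1]$ and almost everywhere positive there. Let $L_N$ be the $L^r$ dual quantization distortion function of $\mu_N$ on $\mathcal{S}^{0,1}_N$. Then $x^\star=\big(\frac{k-1}{N-1}\big)_{k=2,\ldots,N-1}$ is a critical point of $L_N$, and for every large enough $N$, $x^\star$ is not a local minimum of $L_N$; consequently, for every large enough $N$, the equation $\nabla L_N(x)=0$ has at least two distinct solutions in $\mathcal{S}^{0,1}_N$.
   Context: $\varpi_r(u)=u^r(1-u)+(1-u)^ru$ for $u\in[0,1]$, and $c_r>0$ is the constant such that $g=c_r\varpi_r$ is a probability density on $[0,1]$. $\{\cdot\}$ denotes the fractional part. $\mathcal{S}^{0,1}_N=\{(x_2,\ldots,x_{N-1})\in(0,1)^{N-2}: x_2<\cdots<x_{N-1}\}$. For $x\in\mathcal{S}^{0,1}_N$, with the convention $x_1=0$, $x_N=1$, $$L_N(x)=\sum_{i=1}^{N-1}\int_{(x_i,x_{i+1})}\Big((\xi-x_i)^r\frac{x_{i+1}-\xi}{x_{i+1}-x_i}+(x_{i+1}-\xi)^r\frac{\xi-x_i}{x_{i+1}-x_i}\Big)\mu_N(d\xi).$$ A critical point of $L_N$ is a point where $\nabla L_N=0$. *)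

theory Defs
  imports "HOL-Probability.Probability"
begin

definition varpi :: "real \<Rightarrow> real \<Rightarrow> real" where
  "varpi r u = u powr r * (1 - u) + (1 - u) powr r * u"

definition norm_const :: "real \<Rightarrow> real" where
  "norm_const r = (THE c. c > 0 \<and>
     prob_space (density lborel (\<lambda>u. indicator {0..1} u * ennreal (c * varpi r u))))"

definition g_dens :: "real \<Rightarrow> real \<Rightarrow> real" where
  "g_dens r u = norm_const r * varpi r u"

definition f_dens :: "real \<Rightarrow> nat \<Rightarrow> real \<Rightarrow> real" where
  "f_dens r N u = g_dens r (frac ((real N - 1) * u))"

definition mu :: "real \<Rightarrow> nat \<Rightarrow> real measure" where
  "mu r N = density lborel (\<lambda>u. indicator {0..1} u * ennreal (f_dens r N u))"

text \<open>A tuple \<open>(x\<^sub>2, \<dots>, x\<^sub>N\<^sub>-\<^sub>1)\<close> is a function on \<open>nat\<close> that is \<open>undefined\<close> outside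
  \<open>{2..N-1}\<close>, so that equality of functions is equality of tuples.\<close>

definition simplex01 :: "nat \<Rightarrow> (nat \<Rightarrow> real) set" where
  "simplex01 N = {x \<in> {2..N-1} \<rightarrow>\<^sub>E {0<..<1}. strict_mono_on {2..N-1} x}"

definition with_endpoints :: "nat \<Rightarrow> (nat \<Rightarrow> real) \<Rightarrow> nat \<Rightarrow> real" where
  "with_endpoints N x i = (if i = 1 then 0 else if i = N then 1 else x i)"

definition distortion :: "real \<Rightarrow> nat \<Rightarrow> real measure \<Rightarrow> (nat \<Rightarrow> real) \<Rightarrow> real" where
  "distortion r N M x = (\<Sum>i=1..N-1.
     let a = with_endpoints N x i; b = with_endpoints N x (i + 1) in
       LINT \<xi>:{a<..<b}|M.
         (\<xi> - a) powr r * ((b - \<xi>) / (b - a)) + (b - \<xi>) powr r * ((\<xi> - a) / (b - a)))"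

definition tuple_dist :: "nat \<Rightarrow> (nat \<Rightarrow> real) \<Rightarrow> (nat \<Rightarrow> real) \<Rightarrow> real" where
  "tuple_dist N x y = L2_set (\<lambda>i. y i - x i) {2..N-1}"

text \<open>Since the dimension \<open>N - 2\<close> varies, it cannot be a type; the (Frechet) gradient on the open
  simplex and local minimality are therefore spelled out with the Euclidean distance of tuples.\<close>

definition has_gradient ::
  "nat \<Rightarrow> ((nat \<Rightarrow> real) \<Rightarrow> real) \<Rightarrow> (nat \<Rightarrow> real) \<Rightarrow> (nat \<Rightarrow> real) \<Rightarrow> bool" where
  "has_gradient N F G x \<longleftrightarrow>
     (\<forall>\<epsilon>>0. \<exists>\<delta>>0. \<forall>y\<in>simplex01 N. tuple_dist N x y < \<delta> \<longrightarrow>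
        \<bar>F y - F x - (\<Sum>i=2..N-1. G i * (y i - x i))\<bar> \<le> \<epsilon> * tuple_dist N x y)"

definition critical_point :: "nat \<Rightarrow> ((nat \<Rightarrow> real) \<Rightarrow> real) \<Rightarrow> (nat \<Rightarrow> real) \<Rightarrow> bool" where
  "critical_point N F x \<longleftrightarrow> x \<in> simplex01 N \<and> has_gradient N F (\<lambda>i. 0) x"

definition local_minimum :: "nat \<Rightarrow> ((nat \<Rightarrow> real) \<Rightarrow> real) \<Rightarrow> (nat \<Rightarrow> real) \<Rightarrow> bool" where
  "local_minimum N F x \<longleftrightarrow> x \<in> simplex01 N \<and>
     (\<exists>\<delta>>0. \<forall>y\<in>simplex01 N. tuple_dist N x y < \<delta> \<longrightarrow> F x \<le> F y)"

definition xstar :: "nat \<Rightarrow> nat \<Rightarrow> real" where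
  "xstar N = (\<lambda>k\<in>{2..N-1}. (real k - 1) / (real N - 1))"

text \<open>The normalising constant is well defined.\<close>

lemma norm_const_ex1:
  assumes "r \<ge> 1"
  shows "\<exists>!c. c > 0 \<and>
    prob_space (density lborel (\<lambda>u. indicator {0..1} u * ennreal (c * varpi r u)))"
proof -
  have cont: "continuous_on {0..1} (varpi r)"
    unfolding varpi_def using assms by (intro continuous_intros continuous_on_powr') auto
  have meas: "(\<lambda>u. indicator {0..1} u * ennreal (c * varpi r u)) \<in> borel_measurable lborel" for c
    unfolding varpi_def by measurable
  have nn: "varpi r u \<ge> 0" if "u \<in> {0..1}" for u
    using that by (auto simp: varpi_def)
  define I where "I = integral {0..1} (varpi r)"
  have hI: "(varpi r has_integral I) {0..1}"
    unfolding I_def using cont by (simp add: integrable_continuous_real integrable_integral)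
  have "I \<noteq> 0"
  proof
    assume "I = 0"
    then have "varpi r (1/2) = 0"
      using has_integral_0_cbox_imp_0[of 0 1 "varpi r" "1/2"] cont nn hI by auto
    then show False by (simp add: varpi_def)
  qed
  moreover have "I \<ge> 0" using has_integral_nonneg[OF hI] nn by auto
  ultimately have Ipos: "I > 0" by simp
  have "emeasure (density lborel (\<lambda>u. indicator {0..1} u * ennreal (c * varpi r u))) UNIV
        = ennreal (c * I)" if "c > 0" for c
  proof -
    have "((\<lambda>u. c * varpi r u) has_integral c * I) {0..1}"
      using hI by (rule has_integral_mult_right)
    then have "integral\<^sup>N lborel (\<lambda>u. indicator {0..1} u * ennreal (c * varpi r u)) = ennreal (c * I)"
      using that nn nn_integral_has_integral_lebesgue'[of "{0..1}" "\<lambda>u. c * varpi r u" "c * I"]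
      by (subst mult.commute) simp
    then show ?thesis using meas[of c] by (simp add: emeasure_density)
  qed
  then have "prob_space (density lborel (\<lambda>u. indicator {0..1} u * ennreal (c * varpi r u)))
      \<longleftrightarrow> c * I = 1" if "c > 0" for c
    using that Ipos prob_space.emeasure_space_1 by (fastforce intro!: prob_spaceI)
  note iff = this
  show ?thesis
  proof (rule ex1I[of _ "1 / I"])
    show "1 / I > 0 \<and> prob_space (density lborel
            (\<lambda>u. indicator {0..1} u * ennreal (1 / I * varpi r u)))"
      using iff[of "1 / I"] Ipos nonzero_divide_eq_eq[of I 1 "1 / I"] by (simp del: times_divide_eq_left)
  qed (use iff Ipos in \<open>auto simp: field_simps\<close>)
qed

end

theory Submission imports Defs begin

text \<open>
  After rescaling by \<open>N - 1\<close> the density is the fixed 1-periodic even function \<open>per r\<close>, up to a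
  constant, and the distortion is a sum over consecutive grid points of \<open>cell r a b\<close>. Since
  \<open>per r\<close> is Lipschitz, integrating by parts shows that \<open>cell\<close> is differentiable for \<open>a < b\<close>, with a
  quadratic remainder.

  At the uniform grid all cells are translates of \<open>[0, 1]\<close>, whose reflection symmetry makes the
  contributions of neighbouring cells to each partial derivative cancel. On the other hand \<open>cell r 0 1\<close>
  is the autocorrelation of the density at lag 0; moving all interior points by \<open>s\<close> replaces it by the
  autocorrelation at lag \<open>s\<close>, smaller by at least a multiple of \<open>s\<^sup>2\<close>, in each of the \<open>N - 3\<close>
  interior cells, and this outweighs the change of order \<open>s\<^sup>2\<close> in the two boundary cells. A global
  minimiser, which exists in the open simplex because splitting a cell never increases the
  distortion, is therefore a second critical point.
\<close>

section \<open>The density and its primitive\<close>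

text \<open>The derivative of \<open>varpi r\<close>. The case \<open>r = 1\<close> is separate
  because \<open>0 powr 0 = 0\<close>: otherwise \<open>q\<close> would jump at 0 and continuity on
  the closed unit interval would fail.\<close>

definition dvarpi :: "real \<Rightarrow> real \<Rightarrow> real" where
  "dvarpi r t = (let q = (\<lambda>u. if r = 1 then 1 else u powr (r - 1)) in
     r * q t * (1 - t) - t powr r + (1 - t) powr r - r * q (1 - t) * t)"

definition per :: "real \<Rightarrow> real \<Rightarrow> real" where
  "per r u = varpi r (frac u)"

text \<open>The dual quantization cost of \<open>\<xi>\<close>: the mean \<open>r\<close>-th power
  of its distance to a random end point of \<open>[a, b]\<close> whose expectation is
  \<open>\<xi>\<close>. On \<open>[0, 1]\<close> it is \<open>varpi r\<close>, so the density has
  the shape of the kernel itself.\<close>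

definition kern :: "real \<Rightarrow> real \<Rightarrow> real \<Rightarrow> real \<Rightarrow> real" where
  "kern r a b \<xi> = (\<xi> - a) powr r * ((b - \<xi>) / (b - a)) + (b - \<xi>) powr r * ((\<xi> - a) / (b - a))"

definition cell :: "real \<Rightarrow> real \<Rightarrow> real \<Rightarrow> real" where
  "cell r a b = integral {a..b} (\<lambda>\<xi>. kern r a b \<xi> * per r \<xi>)"

text \<open>The additive constant left open by \<open>SOME\<close> has no effect on
  \<open>moment\<close>, since \<open>dvarpi r\<close> integrates to
  \<open>varpi r 1 - varpi r 0 = 0\<close>.\<close>

definition prim :: "real \<Rightarrow> real \<Rightarrow> real" where
  "prim r = (SOME F. \<forall>x. (F has_real_derivative per r x) (at x))"

text \<open>Parametrised by the left end and the width of a cell. There is no division by the width,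
  so degenerate cells with \<open>h = 0\<close> are covered.\<close>

definition moment :: "real \<Rightarrow> real \<Rightarrow> real \<Rightarrow> real" where
  "moment r a h = integral {0..1} (\<lambda>t. dvarpi r t * prim r (a + h * t))"

text \<open>By the mean value theorem the increment is \<open>f' z * (v - u)\<close> with
  \<open>z\<close> between \<open>u\<close> and \<open>v\<close>, and there \<open>f'\<close> is
  within \<open>L * \<bar>v - u\<bar>\<close> of \<open>f' u\<close>.\<close>

lemma taylor_lipschitz_deriv:
  fixes f f' :: "real \<Rightarrow> real"
  assumes S: "convex S" "u \<in> S" "v \<in> S"
    and der: "\<And>x. x \<in> S \<Longrightarrow> (f has_real_derivative f' x) (at x)"
    and lip: "\<And>x. x \<in> S \<Longrightarrow> \<bar>f' x - f' u\<bar> \<le> L * \<bar>x - u\<bar>"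
  shows "\<bar>f v - f u - f' u * (v - u)\<bar> \<le> L * (v - u)\<^sup>2"
proof (cases "u = v")
  case False
  have seg: "x \<in> S" if "min u v \<le> x" "x \<le> max u v" for x
    using S that closed_segment_subset[of u S v]
    by (auto simp: closed_segment_eq_real_ivl min_def max_def split: if_splits)
  have "\<exists>z. min u v < z \<and> z < max u v \<and> f (max u v) - f (min u v) = (max u v - min u v) * f' z"
    using False by (intro MVT2 der seg) auto
  then obtain z where z: "min u v < z" "z < max u v"
      "f (max u v) - f (min u v) = (max u v - min u v) * f' z"
    by blast
  have eq: "f v - f u = (v - u) * f' z"
    using z(3) by (auto simp: min_def max_def algebra_simps split: if_splits)
  have L: "\<bar>f' z - f' u\<bar> \<le> L * \<bar>z - u\<bar>"
    using lip[OF seg[of z]] z by simp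
  then have L0: "L \<ge> 0"
    using z False by (smt (verit) mult_neg_pos zero_le_mult_iff)
  have "\<bar>f v - f u - f' u * (v - u)\<bar> = \<bar>f' z - f' u\<bar> * \<bar>v - u\<bar>"
    unfolding eq by (simp add: abs_mult[symmetric] algebra_simps)
  also have "\<dots> \<le> (L * \<bar>v - u\<bar>) * \<bar>v - u\<bar>"
    using L0 z by (intro mult_right_mono order_trans[OF L] mult_left_mono) (auto simp: min_def max_def split: if_splits)
  finally show ?thesis by (simp add: power2_eq_square)
qed auto

section \<open>Symmetry and regularity of the periodic density\<close>

lemma varpi_0 [simp]: "varpi r 0 = 0" and varpi_1 [simp]: "varpi r 1 = 0"
  by (auto simp: varpi_def)

lemma varpi_reflect: "varpi r (1 - u) = varpi r u"
  by (simp add: varpi_def)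

lemma varpi_pos: "0 < u \<Longrightarrow> u < 1 \<Longrightarrow> varpi r u > 0"
  by (simp add: varpi_def add_pos_pos)

lemma per_nonneg: "per r u \<ge> 0"
  using frac_ge_0[of u] frac_lt_1[of u] by (simp add: per_def varpi_def)

text \<open>This includes \<open>u = 1\<close>, where \<open>frac\<close> drops to 0, because
  \<open>varpi r\<close> vanishes at both ends.\<close>

lemma per_eq_varpi: "0 \<le> u \<Longrightarrow> u \<le> 1 \<Longrightarrow> per r u = varpi r u"
  by (cases "u = 1") (auto simp: per_def frac_eq)

lemma per_add_int: "per r (u + of_int k) = per r u"
  by (simp add: per_def)

text \<open>Off the integers \<open>frac (- u)\<close> is \<open>1 - frac u\<close>, so evenness is
  the reflection symmetry of \<open>varpi r\<close>.\<close>

lemma per_uminus: "per r (- u) = per r u"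
  by (cases "u \<in> \<int>") (auto simp: per_def frac_neg varpi_reflect frac_eq_0_iff[THEN iffD2])

lemma per_eq_0_iff: "per r u = 0 \<longleftrightarrow> u \<in> \<int>"
proof
  assume "per r u = 0"
  then have "\<not> (0 < frac u)" using varpi_pos[of "frac u" r] frac_lt_1[of u] by (auto simp: per_def)
  then show "u \<in> \<int>" using frac_ge_0[of u] by (simp add: frac_eq_0_iff[symmetric] del: frac_eq_0_iff)
qed (simp add: per_def frac_eq_0_iff[THEN iffD2])

context
  fixes r :: real
  assumes r: "r \<ge> 1"
begin

lemma continuous_on_varpi: "continuous_on {0..1} (varpi r)"
  unfolding varpi_def using r by (intro continuous_intros continuous_on_powr') auto

lemma continuous_on_dvarpi: "continuous_on {0..1} (dvarpi r)"
proof (cases "r = 1")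
  case True
  then show ?thesis
    unfolding dvarpi_def Let_def by (auto intro!: continuous_intros continuous_on_powr')
next
  case False
  then show ?thesis
    unfolding dvarpi_def Let_def using r by (auto intro!: continuous_intros continuous_on_powr')
qed

lemma has_derivative_varpi:
  assumes "0 < t" "t < 1"
  shows "(varpi r has_real_derivative dvarpi r t) (at t)"
proof -
  have "(varpi r has_real_derivative
      (r * t powr (r - 1) * (1 - t) - t powr r + (1 - t) powr r - r * (1 - t) powr (r - 1) * t)) (at t)"
    unfolding varpi_def [abs_def] using assms
    by (auto intro!: derivative_eq_intros simp: algebra_simps)
  moreover have "r = 1 \<Longrightarrow> t powr (r - 1) = 1 \<and> (1 - t) powr (r - 1) = 1" using assms by simp
  ultimately show ?thesis by (cases "r = 1") (simp_all add: dvarpi_def)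
qed

lemma dvarpi_bounded: "\<exists>B>0. \<forall>t\<in>{0..1}. \<bar>dvarpi r t\<bar> \<le> B"
proof -
  have "compact (dvarpi r ` {0..1})"
    using continuous_on_dvarpi by (intro compact_continuous_image) auto
  then obtain B where "B > 0" "\<forall>x\<in>dvarpi r ` {0..1}. norm x \<le> B"
    using compact_imp_bounded bounded_pos by blast
  then show ?thesis by auto
qed

text \<open>The mean value theorem asks for a derivative only strictly between \<open>u\<close> and
  \<open>v\<close>, so the end points 0 and 1 are allowed.\<close>

lemma varpi_mvt:
  assumes "0 \<le> u" "u < v" "v \<le> 1"
  shows "\<exists>z. u < z \<and> z < v \<and> varpi r v - varpi r u = (v - u) * dvarpi r z"
proof -
  have "\<exists>l z. u < z \<and> z < v \<and> (varpi r has_real_derivative l) (at z) \<and> varpi r v - varpi r u = (v - u) * l"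
  proof (rule MVT)
    show "continuous_on {u..v} (varpi r)"
      using assms by (intro continuous_on_subset[OF continuous_on_varpi]) auto
    show "varpi r differentiable (at x)" if "u < x" "x < v" for x
      using has_derivative_varpi[of x] that assms real_differentiable_def by force
  qed (use assms in auto)
  then obtain l z where "u < z" "z < v" "(varpi r has_real_derivative l) (at z)"
      "varpi r v - varpi r u = (v - u) * l" by blast
  then show ?thesis using assms has_derivative_varpi[of z] DERIV_unique by (intro exI[of _ z]) force
qed

lemma per_lipschitz: "\<exists>L>0. \<forall>u v. \<bar>per r u - per r v\<bar> \<le> L * \<bar>u - v\<bar>"
proof -
  obtain B where B: "B > 0" "\<And>t. t \<in> {0..1} \<Longrightarrow> \<bar>dvarpi r t\<bar> \<le> B"
    using dvarpi_bounded by blast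
  have base: "\<bar>varpi r u - varpi r v\<bar> \<le> B * (v - u)" if uv: "0 \<le> u" "u \<le> v" "v \<le> 1" for u v
  proof (cases "u = v")
    case False
    then obtain z where z: "u < z" "z < v" "varpi r v - varpi r u = (v - u) * dvarpi r z"
      using varpi_mvt[of u v] uv by auto
    have "\<bar>varpi r u - varpi r v\<bar> = (v - u) * \<bar>dvarpi r z\<bar>"
      using z uv by (metis abs_minus_commute abs_mult abs_of_nonneg diff_ge_0_iff_ge)
    also have "\<dots> \<le> (v - u) * B" using z uv by (intro mult_left_mono B) auto
    finally show ?thesis by (simp add: mult.commute)
  qed (use B in auto)
  have "\<bar>per r u - per r v\<bar> \<le> B * (v - u)" if "u \<le> v" for u v
  proof (cases "\<lfloor>u\<rfloor> = \<lfloor>v\<rfloor>")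
    case True
    then show ?thesis
      using base[of "frac u" "frac v"] frac_lt_1[of v] frac_ge_0[of u] that
      by (simp add: per_def frac_def)
  next
    \<comment> \<open>An integer separates \<open>u\<close> from \<open>v\<close>, and
      \<open>per r\<close> vanishes there: each value is at most \<open>B\<close> times the distance
      to an integer in between, and these two distances add up to at most
      \<open>v - u\<close>.\<close>
    case False
    then have fl: "real_of_int \<lfloor>u\<rfloor> + 1 \<le> of_int \<lfloor>v\<rfloor>"
      using floor_mono[OF that] by linarith
    have "varpi r (frac u) \<le> B * (1 - frac u)" "varpi r (frac v) \<le> B * frac v"
      using base[of "frac u" 1] base[of 0 "frac v"] frac_lt_1[of u] frac_lt_1[of v] by auto
    moreover have "per r u \<ge> 0" "per r v \<ge> 0" by (rule per_nonneg)+
    ultimately have "\<bar>per r u - per r v\<bar> \<le> B * (1 - frac u) + B * frac v"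
      by (auto simp: per_def)
    also have "\<dots> \<le> B * (v - u)"
      using fl B(1) by (simp add: distrib_left[symmetric] frac_def)
    finally show ?thesis .
  qed
  then have "\<bar>per r u - per r v\<bar> \<le> B * \<bar>u - v\<bar>" for u v
    by (smt (verit))
  then show ?thesis using B(1) by blast
qed

lemma continuous_on_per: "continuous_on S (per r)"
proof -
  obtain L where "L > 0" "\<And>u v. \<bar>per r u - per r v\<bar> \<le> L * \<bar>u - v\<bar>"
    using per_lipschitz by blast
  then have "L-lipschitz_on S (per r)" by (auto simp: lipschitz_on_def dist_real_def)
  then show ?thesis by (rule lipschitz_on_continuous_on)
qed

lemma continuous_on_per' [continuous_intros]:
  "continuous_on S f \<Longrightarrow> continuous_on S (\<lambda>x. per r (f x))"
  using continuous_on_compose2[OF continuous_on_per[of UNIV]] by blast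

section \<open>Primitive and moments of the density\<close>

lemma prim_deriv: "(prim r has_real_derivative per r x) (at x)"
proof -
  have "isCont (per r) x" for x
    using continuous_on_per[of UNIV] by (simp add: continuous_on_eq_continuous_at)
  then have "\<exists>F. \<forall>x. (F has_real_derivative per r x) (at x)"
    using einterval_antiderivative[of "-\<infinity>" "\<infinity>" "per r"]
    by (auto simp: has_real_derivative_iff_has_vector_derivative)
  then show ?thesis unfolding prim_def by (rule someI2_ex) auto
qed

lemma continuous_on_prim [continuous_intros]:
  "continuous_on S f \<Longrightarrow> continuous_on S (\<lambda>x. prim r (f x))"
  using continuous_on_compose2[of UNIV "prim r" S f] prim_deriv DERIV_isCont
  by (metis continuous_at_imp_continuous_on subset_UNIV)

text \<open>By periodicity the increment over one period has derivative zero in \<open>x\<close>, so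
  it can be evaluated at \<open>x = 0\<close>.\<close>

lemma prim_add_1: "prim r (x + 1) - prim r x = integral {0..1} (varpi r)"
proof -
  have "((\<lambda>x. prim r (x + 1) - prim r x) has_real_derivative 0) (at x)" for x
    using per_add_int[of r x 1]
    by (auto intro!: derivative_eq_intros DERIV_chain2[OF prim_deriv])
  then have "prim r (x + 1) - prim r x = prim r (0 + 1) - prim r 0"
    by (intro DERIV_isconst_all) auto
  moreover have "(per r has_integral prim r 1 - prim r 0) {0..1}"
    by (intro fundamental_theorem_of_calculus)
       (auto simp: has_real_derivative_iff_has_vector_derivative[symmetric]
          intro: prim_deriv has_field_derivative_at_within)
  then have "integral {0..1} (varpi r) = prim r 1 - prim r 0"
    by (subst (asm) has_integral_cong[where g = "varpi r"]) (auto simp: per_eq_varpi)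
  ultimately show ?thesis by simp
qed

text \<open>Since \<open>per r\<close> is Lipschitz, \<open>prim r\<close> has a quadratic Taylor
  remainder; integrating it against the bounded \<open>dvarpi r\<close> gives a constant
  \<open>C\<close> uniform in the base point and the increment.\<close>

lemma moment_taylor:
  "\<exists>C. \<forall>a h. \<exists>P Q. \<forall>a' h'. \<bar>moment r a' h' - moment r a h - P * (a' - a) - Q * (h' - h)\<bar>
      \<le> C * (\<bar>a' - a\<bar> + \<bar>h' - h\<bar>)\<^sup>2"
proof -
  obtain B where B: "B > 0" "\<And>t. t \<in> {0..1} \<Longrightarrow> \<bar>dvarpi r t\<bar> \<le> B"
    using dvarpi_bounded by blast
  obtain L where L: "L > 0" "\<And>u v. \<bar>per r u - per r v\<bar> \<le> L * \<bar>u - v\<bar>"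
    using per_lipschitz by blast
  note ci = continuous_intros continuous_on_dvarpi
  have "\<bar>moment r a' h' - moment r a h - integral {0..1} (\<lambda>t. dvarpi r t * per r (a + h * t)) * (a' - a)
      - integral {0..1} (\<lambda>t. dvarpi r t * per r (a + h * t) * t) * (h' - h)\<bar>
      \<le> B * L * (\<bar>a' - a\<bar> + \<bar>h' - h\<bar>)\<^sup>2" (is "\<bar>?lhs\<bar> \<le> _") for a h a' h'
  proof -
    \<comment> \<open>The pointwise Taylor remainder of \<open>prim r\<close> at
      \<open>a + h * t\<close>, weighted by \<open>dvarpi r t\<close>.\<close>
    define R where "R t = dvarpi r t * (prim r (a' + h' * t) - prim r (a + h * t)
        - per r (a + h * t) * ((a' + h' * t) - (a + h * t)))" for t
    have "((\<lambda>t. dvarpi r t * prim r (a' + h' * t) - dvarpi r t * prim r (a + h * t)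
        - dvarpi r t * per r (a + h * t) * (a' - a) - dvarpi r t * per r (a + h * t) * t * (h' - h))
        has_integral ?lhs) {0..1}"
      unfolding moment_def
      by (intro has_integral_diff has_integral_mult_left integrable_integral
          integrable_continuous_interval ci)
    also have "(\<lambda>t. dvarpi r t * prim r (a' + h' * t) - dvarpi r t * prim r (a + h * t)
        - dvarpi r t * per r (a + h * t) * (a' - a) - dvarpi r t * per r (a + h * t) * t * (h' - h)) = R"
      by (auto simp: R_def algebra_simps)
    finally have "?lhs = integral {0..1} R" by (simp add: integral_unique)
    also have "norm (integral {0..1} R) \<le> B * L * (\<bar>a' - a\<bar> + \<bar>h' - h\<bar>)\<^sup>2 * (1 - 0)"
    proof (rule integral_bound)
      show "continuous_on {0..1} R" unfolding R_def by (intro ci)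
      fix t :: real assume t: "t \<in> {0..1}"
      have "\<bar>prim r (a' + h' * t) - prim r (a + h * t) - per r (a + h * t) * ((a' + h' * t) - (a + h * t))\<bar>
          \<le> L * ((a' + h' * t) - (a + h * t))\<^sup>2"
        by (rule taylor_lipschitz_deriv[of UNIV]) (auto intro: prim_deriv L)
      also have "\<dots> \<le> L * (\<bar>a' - a\<bar> + \<bar>h' - h\<bar>)\<^sup>2"
      proof -
        have "(a' + h' * t) - (a + h * t) = (a' - a) + (h' - h) * t" by (simp add: algebra_simps)
        moreover have "\<bar>(h' - h) * t\<bar> \<le> \<bar>h' - h\<bar>" using t by (simp add: abs_mult mult_left_le)
        ultimately have "\<bar>(a' + h' * t) - (a + h * t)\<bar> \<le> \<bar>\<bar>a' - a\<bar> + \<bar>h' - h\<bar>\<bar>" by linarith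
        then show ?thesis using L(1) by (intro mult_left_mono) (simp_all add: abs_le_square_iff[symmetric])
      qed
      finally show "norm (R t) \<le> B * L * (\<bar>a' - a\<bar> + \<bar>h' - h\<bar>)\<^sup>2"
        unfolding R_def using B t L(1) by (simp add: abs_mult mult.assoc) (intro mult_mono, auto)
    qed simp
    finally show ?thesis by simp
  qed
  then show ?thesis by blast
qed

end

section \<open>Single cells\<close>

lemma kern_reflect: "kern r (- b) (- a) \<xi> = kern r a b (- \<xi>)"
proof -
  have "\<xi> - - b = b - - \<xi>" "- a - \<xi> = - \<xi> - a" "- a - - b = b - a" by simp_all
  \<comment> \<open>After these rewrites both sides consist of the same two summands in opposite
    order.\<close>
  then show ?thesis unfolding kern_def by (simp only: add.commute)
qed

text \<open>The symmetry of the kernel under reflection meets the evenness of the density.\<close>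

lemma cell_reflect: "cell r (- b) (- a) = cell r a b"
  using Henstock_Kurzweil_Integration.integral_reflect_real[of b a "\<lambda>\<xi>. kern r a b \<xi> * per r \<xi>"]
  by (simp add: cell_def kern_reflect per_uminus)

lemma cell_degenerate [simp]: "cell r a a = 0"
  by (simp add: cell_def)

section \<open>Expansions with quadratic remainder\<close>

text \<open>A product rule that keeps the order of the remainder, meant for the product formula
  \<open>cell_moment\<close> around width 1.\<close>

lemma quadratic_expansion_mult:
  fixes f g :: "real \<Rightarrow> real"
  assumes f: "\<And>s. \<bar>s\<bar> \<le> \<delta> \<Longrightarrow> \<bar>f s - f 0 - d * s\<bar> \<le> C * s\<^sup>2"
    and g: "\<And>s. \<bar>s\<bar> \<le> \<delta> \<Longrightarrow> \<bar>g s - g 0 - d' * s\<bar> \<le> C' * s\<^sup>2"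
    and \<delta>: "0 < \<delta>" "\<delta> \<le> 1"
  shows "\<exists>K. \<forall>s. \<bar>s\<bar> \<le> \<delta> \<longrightarrow> \<bar>f s * g s - f 0 * g 0 - (d * g 0 + f 0 * d') * s\<bar> \<le> K * s\<^sup>2"
proof (intro exI allI impI)
  fix s assume s: "\<bar>s\<bar> \<le> \<delta>"
  define e e' where "e = f s - f 0 - d * s" and "e' = g s - g 0 - d' * s"
  have e: "\<bar>e\<bar> \<le> C * s\<^sup>2" and e': "\<bar>e'\<bar> \<le> C' * s\<^sup>2"
    using f[OF s] g[OF s] by (auto simp: e_def e'_def)
  have C: "C \<ge> 0" using f[of \<delta>] \<delta> by (smt (verit) zero_le_mult_iff zero_less_power)
  have s1: "\<bar>s\<bar> \<le> 1" "s\<^sup>2 \<le> 1" using s \<delta> by (auto simp: abs_square_le_1)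
  have g1: "\<bar>g s\<bar> \<le> \<bar>g 0\<bar> + \<bar>d'\<bar> + \<bar>C'\<bar>"
  proof -
    have "\<bar>d' * s\<bar> \<le> \<bar>d'\<bar>" using s1 by (simp add: abs_mult mult_left_le)
    moreover have "\<bar>e'\<bar> \<le> \<bar>C'\<bar>"
    proof -
      have "C' * s\<^sup>2 \<le> \<bar>C'\<bar> * s\<^sup>2" by (intro mult_right_mono) auto
      also have "\<dots> \<le> \<bar>C'\<bar>" using s1 by (simp add: mult_left_le)
      finally show ?thesis using e' by linarith
    qed
    ultimately show ?thesis unfolding e'_def by linarith
  qed
  \<comment> \<open>Inserting both expansions cancels the constant and linear terms; every term left
    contains \<open>s\<^sup>2\<close> or one of the remainders \<open>e\<close>,
    \<open>e'\<close>.\<close>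
  have "f s * g s - f 0 * g 0 - (d * g 0 + f 0 * d') * s = e * g s + f 0 * e' + d * d' * s\<^sup>2 + d * s * e'"
    by (simp add: e_def e'_def algebra_simps power2_eq_square)
  also have "\<bar>\<dots>\<bar> \<le> \<bar>e\<bar> * \<bar>g s\<bar> + \<bar>f 0\<bar> * \<bar>e'\<bar> + \<bar>d * d'\<bar> * s\<^sup>2 + \<bar>d\<bar> * \<bar>s\<bar> * \<bar>e'\<bar>"
  proof -
    have "\<bar>w + x + y + z\<bar> \<le> \<bar>w\<bar> + \<bar>x\<bar> + \<bar>y\<bar> + \<bar>z\<bar>" for w x y z :: real by linarith
    from this[of "e * g s" "f 0 * e'" "d * d' * s\<^sup>2" "d * s * e'"] show ?thesis
      by (simp add: abs_mult)
  qed
  also have "\<dots> \<le> (C * s\<^sup>2) * (\<bar>g 0\<bar> + \<bar>d'\<bar> + \<bar>C'\<bar>) + \<bar>f 0\<bar> * (C' * s\<^sup>2) + \<bar>d * d'\<bar> * s\<^sup>2 + \<bar>d\<bar> * 1 * (C' * s\<^sup>2)"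
    using e e' g1 s1 C by (intro add_mono mult_mono) auto
  also have "\<dots> = (C * (\<bar>g 0\<bar> + \<bar>d'\<bar> + \<bar>C'\<bar>) + \<bar>f 0\<bar> * C' + \<bar>d * d'\<bar> + \<bar>d\<bar> * C') * s\<^sup>2"
    by (simp add: algebra_simps)
  finally show "\<bar>f s * g s - f 0 * g 0 - (d * g 0 + f 0 * d') * s\<bar>
      \<le> (C * (\<bar>g 0\<bar> + \<bar>d'\<bar> + \<bar>C'\<bar>) + \<bar>f 0\<bar> * C' + \<bar>d * d'\<bar> + \<bar>d\<bar> * C') * s\<^sup>2" .
qed

text \<open>The bound \<open>1/2\<close> keeps \<open>1 + s\<close> in \<open>[1/2, 3/2]\<close>,
  away from 0, where the second derivative of the power is unbounded for
  \<open>1 < r < 2\<close>.\<close>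

lemma powr_quadratic_expansion:
  fixes r :: real
  shows "\<exists>C. \<forall>s. \<bar>s\<bar> \<le> 1/2 \<longrightarrow> \<bar>(1 + s) powr r - 1 - r * s\<bar> \<le> C * s\<^sup>2"
proof -
  let ?S = "{1/2..3/2::real}"
  have "compact ((\<lambda>x. r * ((r - 1) * x powr (r - 2))) ` ?S)"
    by (intro compact_continuous_image continuous_intros) auto
  then obtain B where B: "\<And>x. x \<in> ?S \<Longrightarrow> \<bar>r * ((r - 1) * x powr (r - 2))\<bar> \<le> B"
    using compact_imp_bounded bounded_real by (metis (no_types, lifting) image_eqI)
  have "\<bar>r * x powr (r - 1) - r * 1 powr (r - 1)\<bar> \<le> B * \<bar>x - 1\<bar>" if "x \<in> ?S" for x
  proof -
    have "norm (r * x powr (r - 1) - r * 1 powr (r - 1)) \<le> B * norm (x - 1)"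
    proof (rule field_differentiable_bound[where S = ?S and f' = "\<lambda>x. r * ((r - 1) * x powr (r - 2))"])
      fix z :: real assume "z \<in> ?S"
      then show "((\<lambda>x. r * x powr (r - 1)) has_field_derivative r * ((r - 1) * z powr (r - 2))) (at z within ?S)"
        by (auto intro!: derivative_eq_intros simp: algebra_simps)
    qed (use that B in auto)
    then show ?thesis by simp
  qed
  note lip = this
  have "\<bar>v powr r - 1 powr r - r * 1 powr (r - 1) * (v - 1)\<bar> \<le> B * (v - 1)\<^sup>2" if "v \<in> ?S" for v
    using that lip
    by (intro taylor_lipschitz_deriv[of ?S 1 v "\<lambda>x. x powr r" "\<lambda>x. r * x powr (r - 1)"])
       (auto intro!: derivative_eq_intros)
  note bound = this
  have "\<bar>(1 + s) powr r - 1 - r * s\<bar> \<le> B * s\<^sup>2" if "\<bar>s\<bar> \<le> 1/2" for s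
  proof -
    have "1 + s \<in> ?S" using that by (simp add: abs_le_iff) linarith
    from bound[OF this] show ?thesis by simp
  qed
  then show ?thesis by blast
qed

context
  fixes r :: real
  assumes r: "r \<ge> 1"
begin

section \<open>Rescaling a cell to the unit interval\<close>

lemma continuous_on_kern: "a < b \<Longrightarrow> continuous_on {a..b} (kern r a b)"
  unfolding kern_def using r by (intro continuous_intros continuous_on_powr') auto

text \<open>Substituting \<open>\<xi> = a + (b - a) * t\<close> extracts the power \<open>r\<close>
  from the homogeneous kernel and one more from the change of variable. The weight \<open>q\<close>
  is general so that both \<open>per r\<close> and its rescaled version can be inserted.\<close>

lemma integral_kern:
  assumes ab: "a < b" and q: "continuous_on {a..b} q"
  shows "integral {a..b} (\<lambda>\<xi>. kern r a b \<xi> * q \<xi>) =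
    (b - a) powr (r + 1) * integral {0..1} (\<lambda>t. varpi r t * q (a + (b - a) * t))"
proof -
  have kern: "kern r a b (a + (b - a) * t) = (b - a) powr r * varpi r t" if "t \<in> {0..1}" for t
  proof -
    have "b - (a + (b - a) * t) = (b - a) * (1 - t)" "a + (b - a) * t - a = (b - a) * t"
      by (simp_all add: algebra_simps)
    then show ?thesis
      using ab that by (simp add: kern_def varpi_def powr_mult distrib_left)
  qed
  have "((\<lambda>t. (b - a) *\<^sub>R (kern r a b (a + (b - a) * t) * q (a + (b - a) * t))) has_integral
      integral {a + (b - a) * 0..a + (b - a) * 1} (\<lambda>\<xi>. kern r a b \<xi> * q \<xi>)) {0..1}"
  proof (rule has_integral_substitution)
    show "(\<lambda>t. a + (b - a) * t) ` {0..1} \<subseteq> {a..b}"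
    proof clarify
      fix t :: real assume "t \<in> {0..1}"
      then have "0 \<le> (b - a) * t" "(b - a) * t \<le> (b - a) * 1"
        using ab by (auto intro: mult_left_mono)
      then show "a + (b - a) * t \<in> {a..b}" by simp
    qed
    show "continuous_on {a..b} (\<lambda>\<xi>. kern r a b \<xi> * q \<xi>)"
      using ab q continuous_on_kern by (intro continuous_intros)
  qed (use ab in \<open>auto intro!: derivative_eq_intros\<close>)
  then have "integral {0..1} (\<lambda>t. (b - a) * (kern r a b (a + (b - a) * t) * q (a + (b - a) * t)))
      = integral {a..b} (\<lambda>\<xi>. kern r a b \<xi> * q \<xi>)"
    by (intro integral_unique) simp
  also have "integral {0..1} (\<lambda>t. (b - a) * (kern r a b (a + (b - a) * t) * q (a + (b - a) * t)))
      = integral {0..1} (\<lambda>t. (b - a) powr (r + 1) * (varpi r t * q (a + (b - a) * t)))"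
    using ab by (intro integral_cong) (simp add: kern powr_add)
  finally show ?thesis by simp
qed

lemma cell_eq:
  "a < b \<Longrightarrow> cell r a b = (b - a) powr (r + 1) * integral {0..1} (\<lambda>t. varpi r t * per r (a + (b - a) * t))"
  unfolding cell_def by (intro integral_kern continuous_on_per r)

lemma cell_shift: "cell r (a + of_int k) (b + of_int k) = cell r a b"
proof (cases "a < b")
  case True
  have "per r (a + of_int k + (b - a) * t) = per r (a + (b - a) * t)" for t
    using per_add_int[of r "a + (b - a) * t" k] by (simp add: algebra_simps)
  then show ?thesis using True by (simp add: cell_eq)
\<comment> \<open>For \<open>b < a\<close> both integrals run over the empty set, for
  \<open>a = b\<close> over a single point.\<close>
qed (cases "a = b"; simp add: cell_def)

text \<open>Integration by parts moves the derivative onto the weight, so that the density enters only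
  through its primitive.\<close>

lemma cell_moment:
  assumes "a \<le> b"
  shows "cell r a b = - ((b - a) powr r * moment r a (b - a))"
proof (cases "a = b")
  case False
  then have ab: "a < b" using assms by simp
  let ?J = "integral {0..1} (\<lambda>t. varpi r t * per r (a + (b - a) * t))"
  note ci = continuous_intros continuous_on_varpi[OF r] continuous_on_dvarpi[OF r]
    continuous_on_per'[OF r] continuous_on_prim[OF r]
  \<comment> \<open>The boundary terms vanish with \<open>varpi r\<close>. The interior form of the
    fundamental theorem is used because \<open>dvarpi r\<close> is known as derivative only inside
    the unit interval.\<close>
  have "((\<lambda>t. dvarpi r t * prim r (a + (b - a) * t) + varpi r t * (per r (a + (b - a) * t) * (b - a)))
      has_integral varpi r 1 * prim r (a + (b - a) * 1) - varpi r 0 * prim r (a + (b - a) * 0)) {0..1}"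
  proof (rule fundamental_theorem_of_calculus_interior)
    show "continuous_on {0..1} (\<lambda>t. varpi r t * prim r (a + (b - a) * t))"
      by (intro ci)
    fix t :: real assume "t \<in> {0<..<1}"
    then have "((\<lambda>t. varpi r t * prim r (a + (b - a) * t)) has_real_derivative
        dvarpi r t * prim r (a + (b - a) * t) + varpi r t * (per r (a + (b - a) * t) * (b - a))) (at t)"
      by (auto intro!: derivative_eq_intros has_derivative_varpi[OF r] DERIV_chain2[OF prim_deriv[OF r]])
    then show "((\<lambda>t. varpi r t * prim r (a + (b - a) * t)) has_vector_derivative
        dvarpi r t * prim r (a + (b - a) * t) + varpi r t * (per r (a + (b - a) * t) * (b - a))) (at t)"
      by (simp add: has_real_derivative_iff_has_vector_derivative)
  qed simp
  moreover have "((\<lambda>t. dvarpi r t * prim r (a + (b - a) * t) + varpi r t * per r (a + (b - a) * t) * (b - a))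
      has_integral moment r a (b - a) + ?J * (b - a)) {0..1}"
    unfolding moment_def
    by (intro has_integral_add has_integral_mult_left integrable_integral
        integrable_continuous_interval ci)
  ultimately have "moment r a (b - a) + ?J * (b - a) = 0"
    by (simp add: mult.assoc has_integral_unique)
  then have "(b - a) * ?J = - moment r a (b - a)" by (simp add: algebra_simps)
  moreover have "cell r a b = (b - a) powr r * ((b - a) * ?J)"
    using ab by (simp add: cell_eq powr_add)
  ultimately show ?thesis by simp
qed simp

section \<open>Differentiability and continuity of a cell in its end points\<close>

lemma moment_has_derivative:
  "\<exists>P Q. ((\<lambda>z. moment r (fst z) (snd z)) has_derivative (\<lambda>d. P * fst d + Q * snd d)) (at (a, h))"
proof -
  obtain C where C: "\<forall>a h. \<exists>P Q. \<forall>a' h'. \<bar>moment r a' h' - moment r a h - P * (a' - a) - Q * (h' - h)\<bar>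
      \<le> C * (\<bar>a' - a\<bar> + \<bar>h' - h\<bar>)\<^sup>2"
    using moment_taylor[OF r] by blast
  obtain P Q where PQ: "\<And>a' h'. \<bar>moment r a' h' - moment r a h - P * (a' - a) - Q * (h' - h)\<bar>
      \<le> C * (\<bar>a' - a\<bar> + \<bar>h' - h\<bar>)\<^sup>2"
    using C by blast
  have C0: "C \<ge> 0" using PQ[of "a + 1" h] by simp
  have "(\<lambda>d. norm (moment r (fst ((a, h) + d)) (snd ((a, h) + d)) - moment r (fst (a, h)) (snd (a, h))
      - (P * fst d + Q * snd d)) / norm d) \<midarrow>0\<rightarrow> 0"
  \<comment> \<open>The factor 4 is the square of 2 in
    \<open>\<bar>fst d\<bar> + \<bar>snd d\<bar> \<le> 2 * norm d\<close>.\<close>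
  proof (rule Lim_null_comparison[where g = "\<lambda>d. 4 * C * norm d"])
    show "\<forall>\<^sub>F d in at 0. norm (norm (moment r (fst ((a, h) + d)) (snd ((a, h) + d))
        - moment r (fst (a, h)) (snd (a, h)) - (P * fst d + Q * snd d)) / norm d) \<le> 4 * C * norm d"
    proof (rule always_eventually, rule allI)
      fix d :: "real \<times> real"
      have "\<bar>fst d\<bar> + \<bar>snd d\<bar> \<le> 2 * norm d"
        using norm_fst_le[of "fst d" "snd d"] norm_snd_le[of "snd d" "fst d"] by simp
      then have "C * (\<bar>fst d\<bar> + \<bar>snd d\<bar>)\<^sup>2 \<le> C * (2 * norm d)\<^sup>2"
        using C0 by (intro mult_left_mono power_mono) auto
      then have "\<bar>moment r (a + fst d) (h + snd d) - moment r a h - (P * fst d + Q * snd d)\<bar>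
          \<le> 4 * C * norm d * norm d"
        using PQ[of "a + fst d" "h + snd d"] by (simp add: power2_eq_square algebra_simps)
      then show "norm (norm (moment r (fst ((a, h) + d)) (snd ((a, h) + d))
          - moment r (fst (a, h)) (snd (a, h)) - (P * fst d + Q * snd d)) / norm d) \<le> 4 * C * norm d"
        using C0 by (cases "d = 0") (auto simp: divide_le_eq)
    qed
    show "(\<lambda>d::real\<times>real. 4 * C * norm d) \<midarrow>0\<rightarrow> 0"
      by (auto intro!: tendsto_eq_intros)
  qed
  then have "((\<lambda>z. moment r (fst z) (snd z)) has_derivative (\<lambda>d. P * fst d + Q * snd d)) (at (a, h))"
    unfolding has_derivative_at
    by (auto intro!: bounded_linear_intros)
  then show ?thesis by blast
qed

text \<open>The product formula \<open>cell_moment\<close> holds on the open half-plane of pairs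
  with \<open>fst z < snd z\<close>, where the power of the width is differentiable too; the product
  and chain rules apply to it.\<close>

lemma cell_has_derivative:
  assumes "a < b"
  shows "\<exists>A B. ((\<lambda>z. cell r (fst z) (snd z)) has_derivative (\<lambda>d. A * fst d + B * snd d)) (at (a, b))"
proof -
  obtain P Q where PQ: "((\<lambda>z. moment r (fst z) (snd z)) has_derivative (\<lambda>d. P * fst d + Q * snd d))
      (at (a, b - a))"
    using moment_has_derivative by blast
  have m: "((\<lambda>z. moment r (fst z) (snd z - fst z)) has_derivative
      (\<lambda>d. P * fst d + Q * (snd d - fst d))) (at (a, b))"
  proof -
    have "((\<lambda>z. (fst z, snd z - fst z)) has_derivative (\<lambda>d. (fst d, snd d - fst d))) (at (a, b))"
      by (auto intro!: derivative_eq_intros)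
    from has_derivative_compose[OF this, of "\<lambda>z. moment r (fst z) (snd z)" "\<lambda>d. P * fst d + Q * snd d"] PQ
    show ?thesis by simp
  qed
  have p: "((\<lambda>z. (snd z - fst z) powr r) has_derivative
      (\<lambda>d. r * (b - a) powr (r - 1) * (snd d - fst d))) (at (a, b))"
  proof -
    have "((\<lambda>x. x powr r) has_derivative (\<lambda>d. r * (b - a) powr (r - 1) * d)) (at (b - a))"
      using assms has_real_derivative_powr[of "b - a" r]
      by (auto simp: has_field_derivative_def)
    moreover have "((\<lambda>z. snd z - fst z) has_derivative (\<lambda>d. snd d - fst d)) (at (a, b))"
      by (auto intro!: derivative_eq_intros)
    ultimately show ?thesis
      using has_derivative_compose[of "\<lambda>z. snd z - fst z" "\<lambda>d. snd d - fst d"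
        "(a, b)" UNIV "\<lambda>x. x powr r" "\<lambda>d. r * (b - a) powr (r - 1) * d"]
      by simp
  qed
  have "((\<lambda>z. cell r (fst z) (snd z)) has_derivative
      (\<lambda>d. - ((b - a) powr r * (P * fst d + Q * (snd d - fst d))
        + r * (b - a) powr (r - 1) * (snd d - fst d) * moment r a (b - a)))) (at (a, b))"
  proof (rule has_derivative_transform_within_open)
    show "((\<lambda>z. - ((snd z - fst z) powr r * moment r (fst z) (snd z - fst z))) has_derivative
      (\<lambda>d. - ((b - a) powr r * (P * fst d + Q * (snd d - fst d))
        + r * (b - a) powr (r - 1) * (snd d - fst d) * moment r a (b - a)))) (at (a, b))"
      using has_derivative_minus[OF has_derivative_mult[OF p m]] by simp
    show "open {z::real\<times>real. fst z < snd z}"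
      by (intro open_Collect_less continuous_intros)
  qed (use assms in \<open>auto simp: cell_moment\<close>)
  moreover have "(\<lambda>d::real\<times>real. - ((b - a) powr r * (P * fst d + Q * (snd d - fst d))
        + r * (b - a) powr (r - 1) * (snd d - fst d) * moment r a (b - a)))
      = (\<lambda>d. (- ((b - a) powr r) * (P - Q) + r * (b - a) powr (r - 1) * moment r a (b - a)) * fst d
          + (- ((b - a) powr r) * Q - r * (b - a) powr (r - 1) * moment r a (b - a)) * snd d)"
    by (auto simp: algebra_simps)
  ultimately show ?thesis by metis
qed

text \<open>The diagonal is included, since minimisation runs over grids whose points may
  coincide.\<close>

lemma continuous_on_cell: "continuous_on {z. fst z \<le> snd z} (\<lambda>z. cell r (fst z) (snd z))"
proof -
  have "isCont (\<lambda>z. moment r (fst z) (snd z)) z" for z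
    using moment_has_derivative[of "fst z" "snd z"] has_derivative_continuous by fastforce
  then have "continuous_on UNIV (\<lambda>z. moment r (fst z) (snd z))"
    by (simp add: continuous_on_eq_continuous_at)
  then have m: "continuous_on S (\<lambda>z. moment r (fst z) (snd z - fst z))" for S
  proof -
    have "continuous_on S (\<lambda>z. (fst z, snd z - fst z))" by (intro continuous_intros)
    from continuous_on_compose2[OF \<open>continuous_on UNIV _\<close> this] show ?thesis by simp
  qed
  have "continuous_on {z. fst z \<le> snd z} (\<lambda>z. - ((snd z - fst z) powr r * moment r (fst z) (snd z - fst z)))"
    using r by (intro continuous_intros continuous_on_powr' m) auto
  then show ?thesis
    by (rule continuous_on_eq) (auto simp: cell_moment)
qed

section \<open>Splitting a cell and varying its width\<close>

text \<open>Each summand grows separately with the right end. In the second one the factor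
  \<open>(b - \<xi>) powr (r - 1)\<close> is split off; it is monotone because
  \<open>r \<ge> 1\<close>, and what remains is the barycentric weight of the first summand times
  \<open>\<xi> - a\<close>.\<close>

lemma kern_mono:
  assumes "a \<le> \<xi>" "\<xi> \<le> b" "a < b" "b \<le> c"
  shows "kern r a b \<xi> \<le> kern r a c \<xi>"
proof -
  have fr: "(b - \<xi>) / (b - a) \<le> (c - \<xi>) / (c - a)"
  proof -
    have "(c - \<xi>) * (b - a) - (b - \<xi>) * (c - a) = (c - b) * (\<xi> - a)" by (simp add: algebra_simps)
    also have "\<dots> \<ge> 0" using assms by simp
    finally show ?thesis using assms by (simp add: divide_simps)
  qed
  have pw: "(d - \<xi>) powr r = (d - \<xi>) powr (r - 1) * (d - \<xi>)" if "d \<ge> \<xi>" for d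
    using that powr_mult_base[of "d - \<xi>" "r - 1"] by (simp add: mult.commute)
  have "(\<xi> - a) powr r * ((b - \<xi>) / (b - a)) \<le> (\<xi> - a) powr r * ((c - \<xi>) / (c - a))"
    using fr by (intro mult_left_mono) auto
  moreover have "(b - \<xi>) powr r * ((\<xi> - a) / (b - a)) \<le> (c - \<xi>) powr r * ((\<xi> - a) / (c - a))"
  proof -
    have "(b - \<xi>) powr (r - 1) * ((b - \<xi>) / (b - a)) * (\<xi> - a)
        \<le> (c - \<xi>) powr (r - 1) * ((c - \<xi>) / (c - a)) * (\<xi> - a)"
      using assms fr r by (intro mult_right_mono mult_mono powr_mono2) auto
    then show ?thesis using assms by (simp add: pw)
  qed
  ultimately show ?thesis by (simp add: kern_def)
qed

lemma kern_mono':
  assumes "b \<le> \<xi>" "\<xi> \<le> c" "b < c" "a \<le> b"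
  shows "kern r b c \<xi> \<le> kern r a c \<xi>"
  using kern_mono[of "- c" "- \<xi>" "- b" "- a"] assms by (simp add: kern_reflect)

text \<open>On either part the kernel of the smaller cell is dominated by the kernel of the whole
  cell.\<close>

lemma cell_split:
  assumes "a < b" "b < c"
  shows "cell r a b + cell r b c \<le> cell r a c"
proof -
  let ?f = "\<lambda>\<xi>. kern r a c \<xi> * per r \<xi>"
  have int: "(\<lambda>\<xi>. kern r u v \<xi> * per r \<xi>) integrable_on {x..y}" if "u < v" "u \<le> x" "y \<le> v" for u v x y
    using that
    by (intro integrable_continuous_interval continuous_on_mult continuous_on_per'[OF r]
        continuous_on_id continuous_on_subset[OF continuous_on_kern[of u v]]) auto
  have "cell r a b \<le> integral {a..b} ?f"
    unfolding cell_def using assms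
    by (intro integral_le int mult_right_mono kern_mono per_nonneg) auto
  moreover have "cell r b c \<le> integral {b..c} ?f"
    unfolding cell_def using assms
    by (intro integral_le int mult_right_mono kern_mono' per_nonneg) auto
  moreover have "integral {a..b} ?f + integral {b..c} ?f = cell r a c"
    unfolding cell_def using assms
    by (intro Henstock_Kurzweil_Integration.integral_combine int) auto
  ultimately show ?thesis by linarith
qed

text \<open>The linear terms of the expansions at \<open>s\<close> and \<open>- s\<close> cancel.
  The widths \<open>1 + s\<close> and \<open>1 - s\<close> are those of the two boundary cells after
  a shift, the last cell being reflected to start at 0.\<close>

lemma cell_second_difference:
  "\<exists>K. \<forall>s. \<bar>s\<bar> \<le> 1/2 \<longrightarrow> cell r 0 (1 + s) + cell r 0 (1 - s) - 2 * cell r 0 1 \<le> K * s\<^sup>2"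
proof -
  obtain C where C: "\<And>s. \<bar>s\<bar> \<le> 1/2 \<Longrightarrow> \<bar>(1 + s) powr r - 1 - r * s\<bar> \<le> C * s\<^sup>2"
    using powr_quadratic_expansion by blast
  obtain C' where "\<forall>a h. \<exists>P Q. \<forall>a' h'. \<bar>moment r a' h' - moment r a h - P * (a' - a) - Q * (h' - h)\<bar>
      \<le> C' * (\<bar>a' - a\<bar> + \<bar>h' - h\<bar>)\<^sup>2"
    using moment_taylor[OF r] by blast
  then obtain P Q where PQ: "\<And>a' h'. \<bar>moment r a' h' - moment r 0 1 - P * (a' - 0) - Q * (h' - 1)\<bar>
      \<le> C' * (\<bar>a' - 0\<bar> + \<bar>h' - 1\<bar>)\<^sup>2"
    by blast
  obtain K where K: "\<And>s. \<bar>s\<bar> \<le> 1/2 \<Longrightarrow>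
      \<bar>(1 + s) powr r * moment r 0 (1 + s) - (1 + 0) powr r * moment r 0 (1 + 0)
        - (r * moment r 0 (1 + 0) + (1 + 0) powr r * Q) * s\<bar> \<le> K * s\<^sup>2"
    \<comment> \<open>The left end stays at 0, so the coefficient \<open>P\<close> drops out of the
      moment expansion.\<close>
    using quadratic_expansion_mult[of "1/2" "\<lambda>s. (1 + s) powr r" r C "\<lambda>s. moment r 0 (1 + s)" Q C']
      C PQ[of 0 "1 + s" for s] by auto
  have "cell r 0 (1 + s) + cell r 0 (1 - s) - 2 * cell r 0 1 \<le> (2 * K) * s\<^sup>2" if s: "\<bar>s\<bar> \<le> 1/2" for s
    using K[of s] K[of "- s"] s by (simp add: cell_moment)
  then show ?thesis by blast
qed

end

section \<open>Symmetry and translation of the unit cell\<close>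

context
  fixes r :: real
  assumes r: "r \<ge> 1"
begin

text \<open>Reflecting the unit cell swaps its endpoints, so its two partial derivatives are opposite.\<close>

lemma unit_cell_has_derivative:
  "\<exists>A. \<forall>k::int. ((\<lambda>z. cell r (fst z) (snd z)) has_derivative (\<lambda>d. A * fst d - A * snd d))
      (at (of_int k, of_int k + 1))"
proof -
  obtain A B where AB: "((\<lambda>z. cell r (fst z) (snd z)) has_derivative (\<lambda>d. A * fst d + B * snd d)) (at (0, 1))"
    using cell_has_derivative[OF r, of 0 1] by auto
  have refl: "cell r (1 - b) (1 - a) = cell r a b" for a b
    using cell_shift[OF r, of "- b" 1 "- a"] cell_reflect[of r b a] by simp
  have "((\<lambda>z. (1 - snd z, 1 - fst z)) has_derivative (\<lambda>d. (- snd d, - fst d))) (at (0::real, 1::real))"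
    by (auto intro!: derivative_eq_intros)
  from has_derivative_compose[OF this, of "\<lambda>z. cell r (fst z) (snd z)" "\<lambda>d. A * fst d + B * snd d"] AB
  have "((\<lambda>z. cell r (fst z) (snd z)) has_derivative (\<lambda>d. A * - snd d + B * - fst d)) (at (0, 1))"
    by (simp add: refl)
  \<comment> \<open>The two derivatives are compared in the direction \<open>(1, 0)\<close>.\<close>
  from has_derivative_unique[OF this AB] have "A * - 0 + B * - 1 = A * 1 + B * 0"
    by (auto dest: fun_cong[where x = "(1, 0)"])
  then have B: "B = - A" by simp
  have "((\<lambda>z. cell r (fst z) (snd z)) has_derivative (\<lambda>d. A * fst d - A * snd d))
      (at (of_int k, of_int k + 1))" for k
  proof -
    have "((\<lambda>z. (fst z - of_int k, snd z - of_int k)) has_derivative (\<lambda>d. (fst d, snd d)))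
        (at (of_int k, of_int k + 1))"
      by (auto intro!: derivative_eq_intros)
    moreover have "cell r (a - of_int k) (b - of_int k) = cell r a b" for a b
      using cell_shift[OF r, of a "- k" b] by simp
    ultimately show ?thesis
      using has_derivative_compose[of "\<lambda>z. (fst z - of_int k, snd z - of_int k)" "\<lambda>d. (fst d, snd d)"
          "(of_int k, of_int k + 1)" UNIV "\<lambda>z. cell r (fst z) (snd z)" "\<lambda>d. A * fst d + B * snd d"] AB
      by (simp add: B)
  qed
  then show ?thesis by blast
qed

text \<open>The derivative at 0 is 1 for \<open>r > 1\<close> and 2 for \<open>r = 1\<close>, hence
  at least 1/2 nearby. This slope bounds the difference between the density and its translates from
  below.\<close>

lemma varpi_increasing_near_0:
  "\<exists>\<eta>. 0 < \<eta> \<and> \<eta> \<le> 1/2 \<and> (\<forall>u v. 0 \<le> u \<longrightarrow> u \<le> v \<longrightarrow> v \<le> \<eta> \<longrightarrow> varpi r v - varpi r u \<ge> (v - u) / 2)"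
proof -
  have d0: "dvarpi r 0 \<ge> 1" using r by (auto simp: dvarpi_def)
  obtain d where d: "d > 0" "\<And>t. t \<in> {0..1} \<Longrightarrow> dist t 0 < d \<Longrightarrow> dist (dvarpi r t) (dvarpi r 0) < 1/2"
    using continuous_on_dvarpi[OF r] unfolding continuous_on_iff
    by (metis atLeastAtMost_iff half_gt_zero_iff order_refl zero_le_one zero_less_one)
  define \<eta> where "\<eta> = min (1/2) (d/2)"
  have "varpi r v - varpi r u \<ge> (v - u) / 2" if uv: "0 \<le> u" "u \<le> v" "v \<le> \<eta>" for u v
  proof (cases "u = v")
    case False
    then obtain z where z: "u < z" "z < v" "varpi r v - varpi r u = (v - u) * dvarpi r z"
      using varpi_mvt[OF r, of u v] uv by (auto simp: \<eta>_def)
    have "dvarpi r z \<ge> 1/2"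
    proof -
      have "\<bar>dvarpi r z - dvarpi r 0\<bar> < 1/2"
        using d(2)[of z] z uv by (auto simp: \<eta>_def dist_real_def)
      then show ?thesis using d0 by linarith
    qed
    then have "(v - u) * (1/2) \<le> (v - u) * dvarpi r z"
      using uv by (intro mult_left_mono) auto
    then show ?thesis using z by simp
  qed simp
  then show ?thesis using d(1) by (intro exI[of _ \<eta>]) (auto simp: \<eta>_def)
qed

text \<open>An integral over a full period does not see the translation: its derivative in
  \<open>s\<close> vanishes by periodicity.\<close>

lemma integral_per_square_shift:
  "integral {0..1} (\<lambda>t. (per r (s + t))\<^sup>2) = integral {0..1} (\<lambda>t. (per r t)\<^sup>2)"
proof -
  have "isCont (\<lambda>x. (per r x)\<^sup>2) x" for x
    using continuous_on_per[OF r, of UNIV]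
    by (auto simp: continuous_on_eq_continuous_at intro!: continuous_intros)
  then obtain Q where Q: "\<And>x. (Q has_real_derivative (per r x)\<^sup>2) (at x)"
    using einterval_antiderivative[of "-\<infinity>" "\<infinity>" "\<lambda>x. (per r x)\<^sup>2"]
    by (auto simp: has_real_derivative_iff_has_vector_derivative)
  have int: "integral {0..1} (\<lambda>t. (per r (s + t))\<^sup>2) = Q (s + 1) - Q s" for s
  proof -
    have "((\<lambda>t. (per r (s + t))\<^sup>2) has_integral Q (s + 1) - Q (s + 0)) {0..1}"
    proof (rule fundamental_theorem_of_calculus)
      fix t
      have "((\<lambda>t. Q (s + t)) has_real_derivative (per r (s + t))\<^sup>2) (at t within {0..1})"
        by (rule has_field_derivative_at_within)
           (rule DERIV_cong[OF DERIV_chain2[OF Q]], auto intro!: derivative_eq_intros)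
      then show "((\<lambda>t. Q (s + t)) has_vector_derivative (per r (s + t))\<^sup>2) (at t within {0..1})"
        by (simp add: has_real_derivative_iff_has_vector_derivative)
    qed simp
    then show ?thesis by (simp add: integral_unique)
  qed
  have "((\<lambda>x. Q (x + 1) - Q x) has_real_derivative 0) (at x)" for x
    using per_add_int[of r x 1]
    by (auto intro!: derivative_eq_intros DERIV_chain2[OF Q])
  then have "Q (s + 1) - Q s = Q (0 + 1) - Q 0"
    by (intro DERIV_isconst_all) auto
  then show ?thesis using int[of s] int[of 0] by simp
qed

text \<open>The loss of a translated unit cell is half the squared \<open>L\<^sup>2\<close> distance between the
  density and its translate.\<close>

lemma cell_translate_decrease:
  "\<exists>\<kappa>>0. \<exists>s0>0. \<forall>s. 0 < s \<longrightarrow> s < s0 \<longrightarrow> cell r s (1 + s) \<le> cell r 0 1 - \<kappa> * s\<^sup>2"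
proof -
  obtain \<eta> where \<eta>: "0 < \<eta>" "\<eta> \<le> 1/2"
    "\<And>u v. 0 \<le> u \<Longrightarrow> u \<le> v \<Longrightarrow> v \<le> \<eta> \<Longrightarrow> varpi r v - varpi r u \<ge> (v - u) / 2"
    using varpi_increasing_near_0 by blast
  note ci = continuous_intros continuous_on_per'[OF r]
  have "cell r s (1 + s) \<le> cell r 0 1 - (\<eta> / 16) * s\<^sup>2" if s: "0 < s" "s < \<eta> / 2" for s
  proof -
    let ?D = "\<lambda>t. (per r (s + t) - per r t)\<^sup>2"
    have c: "cell r u (u + 1) = integral {0..1} (\<lambda>t. per r t * per r (u + t))" for u
      by (auto simp: cell_eq[OF r] per_eq_varpi intro!: integral_cong)
    have "((\<lambda>t. (per r (s + t))\<^sup>2 - 2 * (per r t * per r (s + t)) + (per r t)\<^sup>2) has_integral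
        integral {0..1} (\<lambda>t. (per r (s + t))\<^sup>2)
        - 2 * integral {0..1} (\<lambda>t. per r t * per r (s + t)) + integral {0..1} (\<lambda>t. (per r t)\<^sup>2)) {0..1}"
      by (intro has_integral_add has_integral_diff has_integral_mult_right integrable_integral
          integrable_continuous_interval ci)
    also have "(\<lambda>t. (per r (s + t))\<^sup>2 - 2 * (per r t * per r (s + t)) + (per r t)\<^sup>2) = ?D"
      by (auto simp: power2_eq_square algebra_simps)
    finally have D: "integral {0..1} ?D = 2 * (cell r 0 1 - cell r s (1 + s))"
      using c[of s] c[of 0] integral_per_square_shift[of s]
      by (simp add: integral_unique add.commute power2_eq_square)
    \<comment> \<open>For \<open>t \<le> \<eta> / 2\<close> and \<open>s < \<eta> / 2\<close> both
      \<open>t\<close> and \<open>s + t\<close> lie where \<open>varpi r\<close> has slope at least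
      1/2. The resulting \<open>\<eta> * s\<^sup>2 / 8\<close> bounds twice the loss, which explains
      \<open>\<eta> / 16\<close>.\<close>
    have "(s / 2)\<^sup>2 * (\<eta> / 2 - 0) = integral {0..\<eta>/2} (\<lambda>t. (s / 2)\<^sup>2)"
      using \<eta> by simp
    also have "\<dots> \<le> integral {0..\<eta>/2} ?D"
    proof (intro integral_le integrable_continuous_interval ci)
      fix t assume t: "t \<in> {0..\<eta>/2}"
      have "s / 2 \<le> per r (s + t) - per r t"
        using \<eta>(3)[of t "s + t"] \<eta>(2) t s by (simp add: per_eq_varpi)
      then show "(s / 2)\<^sup>2 \<le> ?D t" using s by (intro power_mono) auto
    qed (rule r)+
    also have "\<dots> \<le> integral {0..1} ?D"
      using \<eta> by (intro integral_subset_le integrable_continuous_interval ci) auto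
    finally show ?thesis unfolding D by (simp add: power2_eq_square field_simps)
  qed
  then show ?thesis using \<eta>(1) by (intro exI[of _ "\<eta> / 16"] conjI exI[of _ "\<eta> / 2"]) auto
qed

section \<open>The measure \<open>mu r N\<close> and its cell integrals\<close>

lemma norm_const_pos: "norm_const r > 0"
  and norm_const_integral: "norm_const r * integral {0..1} (varpi r) = 1"
proof -
  let ?c = "norm_const r"
  have c: "?c > 0 \<and> prob_space (density lborel (\<lambda>u. indicator {0..1} u * ennreal (?c * varpi r u)))"
    unfolding norm_const_def by (rule theI'[OF norm_const_ex1[OF r]])
  then show "?c > 0" by simp
  have nn: "varpi r u \<ge> 0" if "u \<in> {0..1}" for u
    using that by (auto simp: varpi_def)
  have "(varpi r has_integral integral {0..1} (varpi r)) {0..1}"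
    using continuous_on_varpi[OF r] by (simp add: integrable_continuous_interval integrable_integral)
  then have "((\<lambda>u. ?c * varpi r u) has_integral ?c * integral {0..1} (varpi r)) {0..1}"
    by (rule has_integral_mult_right)
  then have "integral\<^sup>N lborel (\<lambda>u. indicator {0..1} u * ennreal (?c * varpi r u))
      = ennreal (?c * integral {0..1} (varpi r))"
    using c nn nn_integral_has_integral_lebesgue'[of "{0..1}" "\<lambda>u. ?c * varpi r u"]
    by (subst mult.commute) simp
  moreover have "(\<lambda>u. indicator {0..1} u * ennreal (?c * varpi r u)) \<in> borel_measurable lborel"
    unfolding varpi_def by measurable
  ultimately have "ennreal (?c * integral {0..1} (varpi r)) = 1"
    using prob_space.emeasure_space_1[OF conjunct2[OF c]] by (simp add: emeasure_density)
  then show "?c * integral {0..1} (varpi r) = 1" by simp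
qed

lemma f_dens_eq: "f_dens r N u = norm_const r * per r ((real N - 1) * u)"
  by (simp add: f_dens_def g_dens_def per_def)

lemma f_dens_nonneg: "f_dens r N u \<ge> 0"
  using norm_const_pos per_nonneg by (simp add: f_dens_eq)

lemma continuous_on_f_dens: "continuous_on S (f_dens r N)"
  unfolding f_dens_eq [abs_def] by (intro continuous_intros continuous_on_per'[OF r])

lemma borel_measurable_f_dens [measurable]: "f_dens r N \<in> borel_measurable borel"
  by (intro borel_measurable_continuous_onI continuous_on_f_dens)

text \<open>The zeros are the integer multiples of \<open>1 / (N - 1)\<close>, a countable
  set.\<close>

lemma AE_f_dens_pos:
  assumes "N \<ge> 2"
  shows "AE u in lborel. f_dens r N u > 0"
proof -
  let ?Z = "range (\<lambda>k::int. of_int k / (real N - 1))"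
  have "AE u in lborel. u \<notin> ?Z"
    by (intro AE_not_in countable_imp_null_set_lborel) auto
  then show ?thesis
  proof eventually_elim
    case (elim u)
    have "(real N - 1) * u \<notin> \<int>"
    proof
      assume "(real N - 1) * u \<in> \<int>"
      then obtain k where "(real N - 1) * u = of_int k" by (auto elim: Ints_cases)
      then have "u = of_int k / (real N - 1)" using assms by (simp add: field_simps)
      then show False using elim by blast
    qed
    then show ?case
      using norm_const_pos per_nonneg[of r "(real N - 1) * u"] per_eq_0_iff[of r "(real N - 1) * u"]
      by (simp add: f_dens_eq less_le)
  qed
qed

text \<open>The rescaled argument runs through exactly \<open>N - 1\<close> periods, and the factor
  \<open>1 / (N - 1)\<close> of the primitive compensates for their number.\<close>

lemma prob_space_mu:
  assumes "N \<ge> 2"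
  shows "prob_space (mu r N)"
proof -
  let ?J = "integral {0..1} (varpi r)"
  define n where "n = real N - 1"
  have n: "n > 0" using assms by (simp add: n_def)
  have F: "prim r (real m) - prim r 0 = real m * ?J" for m
  proof (induction m)
    case (Suc m)
    then show ?case
      using prim_add_1[OF r, of "real m"] by (simp add: algebra_simps)
  qed simp
  have "((\<lambda>u. norm_const r * per r (n * u)) has_integral
      norm_const r / n * prim r (n * 1) - norm_const r / n * prim r (n * 0)) {0..1}"
  proof (rule fundamental_theorem_of_calculus)
    fix t
    have "((\<lambda>u. norm_const r / n * prim r (n * u)) has_real_derivative norm_const r * per r (n * t))
        (at t within {0..1})"
      using n by (auto intro!: derivative_eq_intros DERIV_chain2[OF prim_deriv[OF r]])
    then show "((\<lambda>u. norm_const r / n * prim r (n * u)) has_vector_derivative norm_const r * per r (n * t))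
        (at t within {0..1})"
      by (simp add: has_real_derivative_iff_has_vector_derivative)
  qed simp
  moreover have "norm_const r / n * prim r (n * 1) - norm_const r / n * prim r (n * 0) = 1"
  proof -
    have "n = real (N - 1)" using assms by (simp add: n_def)
    then have "prim r n - prim r 0 = n * ?J" using F by simp
    moreover have "norm_const r / n * prim r (n * 1) - norm_const r / n * prim r (n * 0)
        = norm_const r / n * (prim r n - prim r 0)"
      by (simp add: right_diff_distrib)
    ultimately show ?thesis using n norm_const_integral by simp
  qed
  ultimately have "(f_dens r N has_integral 1) {0..1}"
    by (simp add: f_dens_eq [abs_def] n_def)
  then have "integral\<^sup>N lborel (\<lambda>u. indicator {0..1} u * ennreal (f_dens r N u)) = ennreal 1"
    using f_dens_nonneg nn_integral_has_integral_lebesgue'[of "{0..1}" "f_dens r N" 1]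
    by (subst mult.commute) simp
  then show ?thesis
    by (intro prob_spaceI) (simp add: mu_def emeasure_density)
qed

text \<open>Stretching by \<open>N - 1\<close> multiplies the kernel by the power \<open>r\<close>
  and lengths by the power 1, which gives the exponent \<open>- (r + 1)\<close>.\<close>

lemma distortion_term:
  assumes "0 \<le> a" "a < b" "b \<le> 1" "N \<ge> 2"
  shows "(LINT \<xi>:{a<..<b}|mu r N.
      (\<xi> - a) powr r * ((b - \<xi>) / (b - a)) + (b - \<xi>) powr r * ((\<xi> - a) / (b - a)))
    = norm_const r * (real N - 1) powr - (r + 1) * cell r ((real N - 1) * a) ((real N - 1) * b)"
proof -
  define n where "n = real N - 1"
  have n: "n > 0" using assms by (simp add: n_def)
  have [measurable]: "kern r a b \<in> borel_measurable borel"
    unfolding kern_def [abs_def] by measurable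
  have mu: "mu r N = density lborel (\<lambda>u. ennreal (indicator {0..1} u * f_dens r N u))"
    unfolding mu_def by (intro arg_cong2[where f = density]) (auto simp: indicator_def)
  have "(LINT \<xi>:{a<..<b}|mu r N. kern r a b \<xi>)
      = (LINT \<xi>|lborel. (indicator {0..1} \<xi> * f_dens r N \<xi>) *\<^sub>R (indicator {a<..<b} \<xi> *\<^sub>R kern r a b \<xi>))"
    unfolding mu set_lebesgue_integral_def
    by (intro integral_density) (auto simp: f_dens_nonneg)
  also have "\<dots> = (LINT \<xi>:{a..b}|lborel. norm_const r * (kern r a b \<xi> * per r (n * \<xi>)))"
    unfolding set_lebesgue_integral_def
  proof (intro Bochner_Integration.integral_cong refl)
    fix \<xi>
    show "(indicator {0..1} \<xi> * f_dens r N \<xi>) *\<^sub>R (indicator {a<..<b} \<xi> *\<^sub>R kern r a b \<xi>)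
      = indicator {a..b} \<xi> *\<^sub>R (norm_const r * (kern r a b \<xi> * per r (n * \<xi>)))"
      \<comment> \<open>The open interval may be closed because the kernel vanishes at both end
        points.\<close>
      using assms by (cases "\<xi> = a \<or> \<xi> = b") (auto simp: indicator_def f_dens_eq n_def kern_def)
  qed
  also have "\<dots> = norm_const r * integral {a..b} (\<lambda>\<xi>. kern r a b \<xi> * per r (n * \<xi>))"
    using assms
    by (subst set_borel_integral_eq_integral(2))
       (auto intro!: borel_integrable_atLeastAtMost' continuous_intros continuous_on_per'[OF r]
         continuous_on_kern[OF r])
  also have "integral {a..b} (\<lambda>\<xi>. kern r a b \<xi> * per r (n * \<xi>))
      = (b - a) powr (r + 1) * integral {0..1} (\<lambda>t. varpi r t * per r (n * (a + (b - a) * t)))"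
    using assms by (intro integral_kern[OF r] continuous_intros continuous_on_per'[OF r])
  also have "\<dots> = n powr - (r + 1) * cell r (n * a) (n * b)"
  proof -
    have "n * b - n * a = n * (b - a)" by (simp add: algebra_simps)
    moreover have "n * (a + (b - a) * t) = n * a + n * (b - a) * t" for t by (simp add: algebra_simps)
    moreover have "n powr - (r + 1) * n powr (r + 1) = 1"
      using n by (simp flip: powr_add)
    ultimately show ?thesis
      using assms n by (simp add: cell_eq[OF r] powr_mult)
  qed
  finally show ?thesis by (simp add: kern_def n_def)
qed

end

section \<open>Grids and gradients\<close>

definition cell_sum :: "real \<Rightarrow> nat \<Rightarrow> (nat \<Rightarrow> real) \<Rightarrow> real" where
  "cell_sum r N z = (\<Sum>i=1..N-1. cell r ((real N - 1) * z i) ((real N - 1) * z (i + 1)))"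

text \<open>All indices, also those outside \<open>{1..N}\<close>, are confined to the unit
  interval, which makes this a closed subset of a compact product.\<close>

definition closed_grids :: "nat \<Rightarrow> (nat \<Rightarrow> real) set" where
  "closed_grids N = {z. (\<forall>i. 0 \<le> z i \<and> z i \<le> 1) \<and> z 1 = 0 \<and> z N = 1 \<and> (\<forall>i\<in>{1..<N}. z i \<le> z (i + 1))}"

section \<open>Tuples, their end points and the open simplex\<close>

lemma tuple_dist_nonneg: "tuple_dist N x y \<ge> 0"
  by (simp add: tuple_dist_def)

lemma coordinate_le_tuple_dist:
  assumes "i \<in> {2..N-1}"
  shows "\<bar>y i - x i\<bar> \<le> tuple_dist N x y"
proof -
  have "L2_set (\<lambda>i. \<bar>y i - x i\<bar>) {2..N-1} = tuple_dist N x y"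
    by (simp add: tuple_dist_def L2_set_def)
  then show ?thesis
    using member_le_L2_set[of "{2..N-1}" i "\<lambda>i. \<bar>y i - x i\<bar>"] assms by simp
qed

lemma with_endpoints_diff_le: "i \<in> {1..N} \<Longrightarrow> \<bar>with_endpoints N y i - with_endpoints N x i\<bar> \<le> tuple_dist N x y"
  using coordinate_le_tuple_dist[of i N y x] tuple_dist_nonneg[of N x y]
  by (auto simp: with_endpoints_def)

text \<open>For \<open>i = 1\<close> and \<open>i = N\<close> both sides are zero, so boundary cells
  can be treated like interior ones.\<close>

lemma sum_with_endpoints_diff:
  assumes "i \<in> {1..N}"
  shows "(\<Sum>k=2..N-1. (if k = i then c else 0) * (y k - x k)) = c * (with_endpoints N y i - with_endpoints N x i)"
proof (cases "i \<in> {2..N-1}")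
  case True
  then have "with_endpoints N w i = w i" for w by (auto simp: with_endpoints_def)
  then show ?thesis using True
    by (simp add: if_distrib[of "\<lambda>u. u * _"] sum.delta cong: if_cong)
next
  case False
  then have "with_endpoints N y i = with_endpoints N x i" using assms by (auto simp: with_endpoints_def)
  moreover have "(\<Sum>k=2..N-1. (if k = i then c else 0) * (y k - x k)) = 0"
    using False by (intro sum.neutral) auto
  ultimately show ?thesis by simp
qed

lemma with_endpoints_less:
  assumes x: "x \<in> simplex01 N" and i: "1 \<le> i" "i < N"
  shows "with_endpoints N x i < with_endpoints N x (i + 1)"
proof -
  have "x k \<in> {0<..<1}" if "k \<in> {2..N-1}" for k
    using x that by (auto simp: simplex01_def)
  moreover have "x i < x (i + 1)" if "2 \<le> i" "i + 1 \<le> N - 1"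
    using x that by (auto simp: simplex01_def strict_mono_on_def)
  ultimately show ?thesis using i by (auto simp: with_endpoints_def)
qed

lemma with_endpoints_bounds:
  assumes x: "x \<in> simplex01 N" and i: "i \<in> {1..N}"
  shows "0 \<le> with_endpoints N x i" "with_endpoints N x i \<le> 1"
proof -
  have "x k \<in> {0<..<1}" if "k \<in> {2..N-1}" for k
    using x that by (auto simp: simplex01_def)
  from this[of i] i show "0 \<le> with_endpoints N x i" "with_endpoints N x i \<le> 1"
    unfolding atomize_conj by (cases "i = 1 \<or> i = N") (auto simp: with_endpoints_def less_imp_le)
qed

lemma with_endpoints_restrict:
  "z 1 = 0 \<Longrightarrow> z N = 1 \<Longrightarrow> i \<in> {1..N} \<Longrightarrow> with_endpoints N (restrict z {2..N-1}) i = z i"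
  by (auto simp: with_endpoints_def)

lemma restrict_in_simplex01:
  assumes z: "z 1 = 0" "z N = 1" and step: "\<And>i. 1 \<le> i \<Longrightarrow> i < N \<Longrightarrow> z i < z (i + 1)"
  shows "restrict z {2..N-1} \<in> simplex01 N"
proof -
  have less: "z i < z j" if "1 \<le> i" "i < j" "j \<le> N" for i j
    using that(2,1,3)
  proof (induction i j rule: less_Suc_induct)
    case (1 i)
    then show ?case using step[of i] by simp
  next
    case (2 i j k)
    then show ?case by force
  qed
  have "0 < z i \<and> z i < 1" if "i \<in> {2..N-1}" for i
    using less[of 1 i] less[of i N] that z by auto
  then show ?thesis
    using less by (auto simp: simplex01_def strict_mono_on_def)
qed

lemma simplex01_update:
  assumes x: "x \<in> simplex01 N" and i: "i \<in> {2..N-1}"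
  shows "\<exists>\<eta>>0. \<forall>t. \<bar>t\<bar> < \<eta> \<longrightarrow> x(i := x i + t) \<in> simplex01 N"
proof -
  let ?z = "with_endpoints N x"
  \<comment> \<open>The smaller of the two gaps next to point \<open>i\<close>, the fixed end points
    0 and 1 counting as neighbours.\<close>
  define \<eta> where "\<eta> = min (?z i - ?z (i - 1)) (?z (i + 1) - ?z i)"
  have "?z (i - 1) < ?z i" "?z i < ?z (i + 1)"
    using with_endpoints_less[OF x, of "i - 1"] with_endpoints_less[OF x, of i] i by auto
  then have "\<eta> > 0" by (simp add: \<eta>_def)
  moreover have "x(i := x i + t) \<in> simplex01 N" if t: "\<bar>t\<bar> < \<eta>" for t
  proof -
    let ?w = "?z(i := ?z i + t)"
    have xi: "?z k = x k" if "k \<in> {2..N-1}" for k using that by (auto simp: with_endpoints_def)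
    have "restrict ?w {2..N-1} \<in> simplex01 N"
    proof (rule restrict_in_simplex01)
      fix k assume k: "1 \<le> k" "k < N"
      have "?z k < ?z (k + 1)" by (rule with_endpoints_less[OF x k])
      then show "?w k < ?w (k + 1)" using t by (auto simp: \<eta>_def)
    qed (use i in \<open>auto simp: with_endpoints_def\<close>)
    moreover have "restrict ?w {2..N-1} = x(i := x i + t)"
    proof
      fix k show "restrict ?w {2..N-1} k = (x(i := x i + t)) k"
        using x i by (auto simp: xi simplex01_def PiE_def extensional_def)
    qed
    ultimately show ?thesis by simp
  qed
  ultimately show ?thesis by blast
qed

section \<open>Gradient calculus on the simplex\<close>

lemma has_gradientD:
  assumes "has_gradient N F G x" "\<epsilon> > 0"
  shows "\<exists>\<delta>>0. \<forall>y\<in>simplex01 N. tuple_dist N x y < \<delta> \<longrightarrow>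
    \<bar>F y - F x - (\<Sum>i=2..N-1. G i * (y i - x i))\<bar> \<le> \<epsilon> * tuple_dist N x y"
  using assms(1)[unfolded has_gradient_def, rule_format, OF assms(2)] .

lemma has_gradient_cong:
  assumes "has_gradient N F G x" "\<And>y. y \<in> simplex01 N \<Longrightarrow> F' y = F y" "x \<in> simplex01 N"
    "\<And>k. k \<in> {2..N-1} \<Longrightarrow> G' k = G k"
  shows "has_gradient N F' G' x"
proof -
  have "(\<Sum>i=2..N-1. G' i * (y i - x i)) = (\<Sum>i=2..N-1. G i * (y i - x i))" for y
    using assms(4) by (intro sum.cong) auto
  then show ?thesis using assms(1-3) unfolding has_gradient_def by simp
qed

lemma has_gradient_add:
  assumes "has_gradient N F G x" "has_gradient N F' G' x"
  shows "has_gradient N (\<lambda>y. F y + F' y) (\<lambda>k. G k + G' k) x"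
  unfolding has_gradient_def
proof (intro allI impI)
  fix \<epsilon> :: real assume \<epsilon>: "\<epsilon> > 0"
  then have "\<epsilon> / 2 > 0" by simp
  obtain d where d: "d > 0" "\<And>y. y \<in> simplex01 N \<Longrightarrow> tuple_dist N x y < d \<Longrightarrow>
      \<bar>F y - F x - (\<Sum>i=2..N-1. G i * (y i - x i))\<bar> \<le> \<epsilon> / 2 * tuple_dist N x y"
    using has_gradientD[OF assms(1) \<open>\<epsilon> / 2 > 0\<close>] by blast
  obtain d' where d': "d' > 0" "\<And>y. y \<in> simplex01 N \<Longrightarrow> tuple_dist N x y < d' \<Longrightarrow>
      \<bar>F' y - F' x - (\<Sum>i=2..N-1. G' i * (y i - x i))\<bar> \<le> \<epsilon> / 2 * tuple_dist N x y"
    using has_gradientD[OF assms(2) \<open>\<epsilon> / 2 > 0\<close>] by blast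
  show "\<exists>\<delta>>0. \<forall>y\<in>simplex01 N. tuple_dist N x y < \<delta> \<longrightarrow>
      \<bar>F y + F' y - (F x + F' x) - (\<Sum>i=2..N-1. (G i + G' i) * (y i - x i))\<bar> \<le> \<epsilon> * tuple_dist N x y"
  proof (intro exI[of _ "min d d'"] conjI ballI impI)
    fix y assume y: "y \<in> simplex01 N" "tuple_dist N x y < min d d'"
    have "(\<Sum>i=2..N-1. (G i + G' i) * (y i - x i))
        = (\<Sum>i=2..N-1. G i * (y i - x i)) + (\<Sum>i=2..N-1. G' i * (y i - x i))"
      by (simp add: sum.distrib[symmetric] distrib_right)
    then have "\<bar>F y + F' y - (F x + F' x) - (\<Sum>i=2..N-1. (G i + G' i) * (y i - x i))\<bar>
        \<le> \<bar>F y - F x - (\<Sum>i=2..N-1. G i * (y i - x i))\<bar> + \<bar>F' y - F' x - (\<Sum>i=2..N-1. G' i * (y i - x i))\<bar>"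
      by linarith
    also have "\<dots> \<le> \<epsilon> / 2 * tuple_dist N x y + \<epsilon> / 2 * tuple_dist N x y"
      using y by (intro add_mono d d') auto
    finally show "\<bar>F y + F' y - (F x + F' x) - (\<Sum>i=2..N-1. (G i + G' i) * (y i - x i))\<bar>
        \<le> \<epsilon> * tuple_dist N x y" by simp
  qed (use d d' in auto)
qed

lemma has_gradient_0: "has_gradient N (\<lambda>y. 0) (\<lambda>k. 0) x"
  by (auto simp: has_gradient_def tuple_dist_nonneg intro: exI[of _ 1])

lemma has_gradient_sum:
  assumes "finite I" "\<And>i. i \<in> I \<Longrightarrow> has_gradient N (F i) (G i) x"
  shows "has_gradient N (\<lambda>y. \<Sum>i\<in>I. F i y) (\<lambda>k. \<Sum>i\<in>I. G i k) x"
  using assms by (induction I rule: finite_induct) (auto simp: has_gradient_0 intro: has_gradient_add)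

lemma has_gradient_cmult:
  assumes "has_gradient N F G x"
  shows "has_gradient N (\<lambda>y. c * F y) (\<lambda>k. c * G k) x"
  unfolding has_gradient_def
proof (intro allI impI)
  fix \<epsilon> :: real assume \<epsilon>: "\<epsilon> > 0"
  \<comment> \<open>Adding 1 keeps the divisor positive when \<open>c = 0\<close>.\<close>
  then have pos: "\<epsilon> / (\<bar>c\<bar> + 1) > 0" by simp
  obtain d where d: "d > 0"
    "\<And>y. y \<in> simplex01 N \<Longrightarrow> tuple_dist N x y < d \<Longrightarrow>
      \<bar>F y - F x - (\<Sum>i=2..N-1. G i * (y i - x i))\<bar> \<le> \<epsilon> / (\<bar>c\<bar> + 1) * tuple_dist N x y"
    using has_gradientD[OF assms pos] by blast
  show "\<exists>\<delta>>0. \<forall>y\<in>simplex01 N. tuple_dist N x y < \<delta> \<longrightarrow>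
      \<bar>c * F y - c * F x - (\<Sum>i=2..N-1. c * G i * (y i - x i))\<bar> \<le> \<epsilon> * tuple_dist N x y"
  proof (intro exI[of _ d] conjI ballI impI)
    fix y assume y: "y \<in> simplex01 N" "tuple_dist N x y < d"
    have "\<bar>c * F y - c * F x - (\<Sum>i=2..N-1. c * G i * (y i - x i))\<bar>
        = \<bar>c\<bar> * \<bar>F y - F x - (\<Sum>i=2..N-1. G i * (y i - x i))\<bar>"
      by (simp add: abs_mult[symmetric] right_diff_distrib sum_distrib_left mult.assoc)
    also have "\<dots> \<le> (\<bar>c\<bar> + 1) * (\<epsilon> / (\<bar>c\<bar> + 1) * tuple_dist N x y)"
      using d(2)[OF y] by (intro mult_mono) auto
    also have "\<dots> = \<epsilon> * tuple_dist N x y" by simp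
    finally show "\<bar>c * F y - c * F x - (\<Sum>i=2..N-1. c * G i * (y i - x i))\<bar> \<le> \<epsilon> * tuple_dist N x y" .
  qed (use d in auto)
qed

text \<open>The chain rule for a single cell: only its two end points move, each scaled by
  \<open>n\<close>.\<close>

lemma has_gradient_two_coordinates:
  fixes f :: "real \<times> real \<Rightarrow> real"
  assumes i: "1 \<le> i" "i < N" and n: "n > 0"
    and der: "(f has_derivative (\<lambda>d. A * fst d + B * snd d))
      (at (n * with_endpoints N x i, n * with_endpoints N x (i + 1)))"
  shows "has_gradient N (\<lambda>y. f (n * with_endpoints N y i, n * with_endpoints N y (i + 1)))
    (\<lambda>k. (if k = i then n * A else 0) + (if k = i + 1 then n * B else 0)) x"
  unfolding has_gradient_def
proof (intro allI impI)
  fix \<epsilon> :: real assume "\<epsilon> > 0"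
  then have "\<epsilon> / (2 * n) > 0" using n by simp
  define p where "p y = (n * with_endpoints N y i, n * with_endpoints N y (i + 1))" for y
  obtain d where d: "d > 0" "\<And>q. norm (q - p x) < d \<Longrightarrow>
      norm (f q - f (p x) - (A * fst (q - p x) + B * snd (q - p x))) \<le> \<epsilon> / (2 * n) * norm (q - p x)"
    using der \<open>\<epsilon> / (2 * n) > 0\<close> unfolding has_derivative_within_alt p_def[symmetric] by blast
  show "\<exists>\<delta>>0. \<forall>y\<in>simplex01 N. tuple_dist N x y < \<delta> \<longrightarrow>
      \<bar>f (n * with_endpoints N y i, n * with_endpoints N y (i + 1))
        - f (n * with_endpoints N x i, n * with_endpoints N x (i + 1))
        - (\<Sum>k=2..N-1. ((if k = i then n * A else 0) + (if k = i + 1 then n * B else 0)) * (y k - x k))\<bar>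
      \<le> \<epsilon> * tuple_dist N x y"
  \<comment> \<open>The pair of end points moves by at most \<open>2 * n\<close> times the distance
    of the tuples.\<close>
  proof (intro exI[of _ "d / (2 * n)"] conjI ballI impI)
    fix y assume y: "tuple_dist N x y < d / (2 * n)"
    have lin: "(\<Sum>k=2..N-1. ((if k = i then n * A else 0) + (if k = i + 1 then n * B else 0)) * (y k - x k))
        = A * fst (p y - p x) + B * snd (p y - p x)"
      using i unfolding distrib_right sum.distrib
      by (subst (1 2) sum_with_endpoints_diff) (auto simp: p_def algebra_simps)
    have nrm: "norm (p y - p x) \<le> 2 * n * tuple_dist N x y"
    proof -
      have "norm (p y - p x) \<le> \<bar>fst (p y - p x)\<bar> + \<bar>snd (p y - p x)\<bar>"
        using norm_Pair_le[of "fst (p y - p x)" "snd (p y - p x)"]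
        by (simp only: prod.collapse real_norm_def)
      also have "\<dots> = n * \<bar>with_endpoints N y i - with_endpoints N x i\<bar>
          + n * \<bar>with_endpoints N y (i + 1) - with_endpoints N x (i + 1)\<bar>"
        using n by (simp add: p_def abs_mult right_diff_distrib[symmetric])
      also have "\<dots> \<le> n * tuple_dist N x y + n * tuple_dist N x y"
        using i n by (intro add_mono mult_left_mono with_endpoints_diff_le) auto
      finally show ?thesis by simp
    qed
    also have "\<dots> < d" using y n by (simp add: field_simps)
    finally have "\<bar>f (p y) - f (p x) - (A * fst (p y - p x) + B * snd (p y - p x))\<bar>
        \<le> \<epsilon> / (2 * n) * norm (p y - p x)"
      using d(2)[of "p y"] by simp
    also have "\<dots> \<le> \<epsilon> / (2 * n) * (2 * n * tuple_dist N x y)"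
      using nrm \<open>\<epsilon> / (2 * n) > 0\<close> by (intro mult_left_mono) auto
    also have "\<dots> = \<epsilon> * tuple_dist N x y" using n by simp
    finally show "\<bar>f (n * with_endpoints N y i, n * with_endpoints N y (i + 1))
        - f (n * with_endpoints N x i, n * with_endpoints N x (i + 1))
        - (\<Sum>k=2..N-1. ((if k = i then n * A else 0) + (if k = i + 1 then n * B else 0)) * (y k - x k))\<bar>
      \<le> \<epsilon> * tuple_dist N x y"
      unfolding lin by (simp add: p_def)
  qed (use d n in auto)
qed

text \<open>Otherwise a small step in coordinate \<open>i\<close> against the sign of
  \<open>G i\<close> gains \<open>\<bar>G i\<bar> * \<bar>t\<bar>\<close> to first order, with an
  error of at most half of that.\<close>

lemma gradient_zero_at_minimum:
  assumes grad: "has_gradient N F G x" and x: "x \<in> simplex01 N"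
    and min: "\<And>y. y \<in> simplex01 N \<Longrightarrow> F x \<le> F y" and i: "i \<in> {2..N-1}"
  shows "G i = 0"
proof (rule ccontr)
  assume "G i \<noteq> 0"
  then have pos: "\<bar>G i\<bar> / 2 > 0" by simp
  obtain d where d: "d > 0" "\<And>y. y \<in> simplex01 N \<Longrightarrow> tuple_dist N x y < d \<Longrightarrow>
      \<bar>F y - F x - (\<Sum>i=2..N-1. G i * (y i - x i))\<bar> \<le> \<bar>G i\<bar> / 2 * tuple_dist N x y"
    using has_gradientD[OF grad pos] by blast
  obtain \<eta> where \<eta>: "\<eta> > 0" "\<And>t. \<bar>t\<bar> < \<eta> \<Longrightarrow> x(i := x i + t) \<in> simplex01 N"
    using simplex01_update[OF x i] by blast
  define t where "t = - sgn (G i) * (min d \<eta> / 2)"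
  have t: "\<bar>t\<bar> = min d \<eta> / 2" "G i * t = - (\<bar>G i\<bar> * \<bar>t\<bar>)"
    using \<open>G i \<noteq> 0\<close> d \<eta> by (auto simp: t_def abs_mult sgn_if)
  let ?y = "x(i := x i + t)"
  have y: "?y \<in> simplex01 N" using t d \<eta> by auto
  have fin: "finite {2..N-1}" by simp
  have dist: "tuple_dist N x ?y = \<bar>t\<bar>"
  proof -
    have "(\<Sum>k=2..N-1. (?y k - x k)\<^sup>2) = (\<Sum>k=2..N-1. if k = i then t\<^sup>2 else 0)"
      by (intro sum.cong) auto
    also have "\<dots> = t\<^sup>2" using i by (simp add: sum.delta)
    finally show ?thesis by (simp add: tuple_dist_def L2_set_def)
  qed
  have lin: "(\<Sum>k=2..N-1. G k * (?y k - x k)) = G i * t"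
  proof -
    have "(\<Sum>k=2..N-1. G k * (?y k - x k)) = (\<Sum>k=2..N-1. if k = i then G i * t else 0)"
      by (intro sum.cong) auto
    also have "\<dots> = G i * t" using i by (simp add: sum.delta)
    finally show ?thesis .
  qed
  have "tuple_dist N x ?y < d" unfolding dist t(1) using d(1) \<eta>(1) by auto
  from d(2)[OF y this] have "\<bar>F ?y - F x - G i * t\<bar> \<le> \<bar>G i\<bar> / 2 * \<bar>t\<bar>"
    unfolding dist lin .
  then have "\<bar>G i\<bar> * \<bar>t\<bar> \<le> \<bar>G i\<bar> / 2 * \<bar>t\<bar>"
    using min[OF y] t(2) by linarith
  moreover have "\<bar>G i\<bar> * \<bar>t\<bar> > 0" using t(1) d \<eta> \<open>G i \<noteq> 0\<close> by simp
  ultimately show False by linarith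
qed

section \<open>Minimisers over closed grids\<close>

lemma compact_closed_grids: "compact (closed_grids N)"
proof -
  have "compact (PiE UNIV (\<lambda>i::nat. {0..1::real}))"
    using compactin_PiE[of "\<lambda>i::nat. euclidean :: real topology" UNIV "\<lambda>i. {0..1}"]
    by (simp add: euclidean_product_topology)
  moreover have cl: "closed {z::nat \<Rightarrow> real. z i = c}" "closed {z::nat \<Rightarrow> real. z i \<le> z j}" for i j c
    by (intro closed_Collect_eq closed_Collect_le continuous_intros continuous_on_product_coordinates)+
  have "closed ({z::nat \<Rightarrow> real. z 1 = 0} \<inter> {z. z N = 1} \<inter> (\<Inter>i\<in>{1..<N}. {z. z i \<le> z (i + 1)}))"
    by (intro closed_Int closed_INT ballI cl)
  ultimately have "compact (PiE UNIV (\<lambda>i::nat. {0..1::real})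
      \<inter> ({z::nat \<Rightarrow> real. z 1 = 0} \<inter> {z. z N = 1} \<inter> (\<Inter>i\<in>{1..<N}. {z. z i \<le> z (i + 1)})))"
    by (rule compact_Int_closed)
  also have "\<dots> = closed_grids N"
    by (auto simp: closed_grids_def PiE_def Pi_def)
  finally show ?thesis .
qed

text \<open>The grid climbs from 0 to 1, so not all gaps are degenerate; if one is, then somewhere a
  degenerate gap borders on a proper one.\<close>

lemma adjacent_gaps:
  fixes z :: "nat \<Rightarrow> real"
  assumes z: "z \<in> closed_grids N" and k: "1 \<le> k" "k < N" "z k = z (k + 1)"
  shows "\<exists>i. 1 \<le> i \<and> i + 1 < N \<and> (z i < z (i + 1)) \<noteq> (z (i + 1) < z (i + 2))"
proof (rule ccontr)
  assume neg: "\<not> ?thesis"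
  have const: "(z i < z (i + 1)) = (z 1 < z 2)" if "1 \<le> i" "i < N" for i
    using that
  proof (induction i rule: nat_induct_at_least)
    case base
    then show ?case by (simp add: numeral_2_eq_2)
  next
    case (Suc i)
    then have "(z i < z (i + 1)) = (z (i + 1) < z (i + 2))" using neg by auto
    then show ?case using Suc by simp
  qed
  then have "\<not> z 1 < z 2" using const[of k] k by simp
  then have flat: "z (i + 1) = z i" if "1 \<le> i" "i < N" for i
  proof -
    have "z i \<le> z (i + 1)" using z that by (auto simp: closed_grids_def)
    then show ?thesis using const[OF that] \<open>\<not> z 1 < z 2\<close> by simp
  qed
  have "z i = z 1" if "1 \<le> i" "i \<le> N" for i
    using that
  proof (induction i rule: nat_induct_at_least)
    case (Suc i)
    then show ?case using flat[of i] by simp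
  qed simp
  from this[of N] have "z N = z 1" using k by simp
  then show False using z k by (auto simp: closed_grids_def)
qed

context
  fixes r :: real
  assumes r: "r \<ge> 1"
begin

lemma continuous_on_cell_sum:
  assumes "N \<ge> 2"
  shows "continuous_on (closed_grids N) (cell_sum r N)"
  unfolding cell_sum_def [abs_def]
proof (intro continuous_on_sum)
  fix i assume i: "i \<in> {1..N-1}"
  have coord: "continuous_on (closed_grids N) (\<lambda>z. z j)" for j
    by (rule continuous_on_subset[OF continuous_on_product_coordinates]) simp
  have "continuous_on (closed_grids N) (\<lambda>z. ((real N - 1) * z i, (real N - 1) * z (i + 1)))"
    by (intro continuous_on_Pair continuous_on_mult continuous_on_const coord)
  moreover have "(\<lambda>z. ((real N - 1) * z i, (real N - 1) * z (i + 1))) ` closed_grids N \<subseteq> {z. fst z \<le> snd z}"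
    using i assms by (auto simp: closed_grids_def intro!: mult_left_mono)
  ultimately show "continuous_on (closed_grids N) (\<lambda>z. cell r ((real N - 1) * z i) ((real N - 1) * z (i + 1)))"
    using continuous_on_compose2[OF continuous_on_cell[OF r]] by fastforce
qed

text \<open>Splitting a cell never increases the distortion, so among all minimisers one with the largest
  number of proper gaps has no degenerate gap.\<close>

lemma cell_sum_minimum:
  assumes N: "N \<ge> 2"
  shows "\<exists>z\<in>closed_grids N. (\<forall>w\<in>closed_grids N. cell_sum r N z \<le> cell_sum r N w)
    \<and> (\<forall>i. 1 \<le> i \<longrightarrow> i < N \<longrightarrow> z i < z (i + 1))"
proof -
  define n where "n = real N - 1"
  have n: "n > 0" using N by (simp add: n_def)
  define P where "P z \<longleftrightarrow> z \<in> closed_grids N \<and> (\<forall>w\<in>closed_grids N. cell_sum r N z \<le> cell_sum r N w)" for z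
  define gaps where "gaps z = {i\<in>{1..<N}. z i < z (i + 1)}" for z :: "nat \<Rightarrow> real"
  \<comment> \<open>The grid with every point except the last at 0.\<close>
  have "(\<lambda>i. if i = N then 1 else 0) \<in> closed_grids N"
    using N by (auto simp: closed_grids_def)
  then have "closed_grids N \<noteq> {}" by blast
  then obtain z0 where z0: "P z0"
    using continuous_attains_inf[OF compact_closed_grids _ continuous_on_cell_sum[OF N]]
    by (auto simp: P_def)
  have bound: "\<forall>w. P w \<longrightarrow> card (gaps w) \<le> N"
  proof (intro allI impI)
    fix w have "card (gaps w) \<le> card {1..<N}" unfolding gaps_def by (intro card_mono) auto
    then show "card (gaps w) \<le> N" by simp
  qed
  obtain z where z: "P z" "\<And>w. P w \<Longrightarrow> card (gaps w) \<le> card (gaps z)"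
    using ex_has_greatest_nat[of P z0 "\<lambda>w. card (gaps w)" "N + 1"] z0 bound by fastforce
  have zg: "z \<in> closed_grids N" using z(1) by (simp add: P_def)
  have "z k < z (k + 1)" if k: "1 \<le> k" "k < N" for k
  proof (rule ccontr)
    assume "\<not> z k < z (k + 1)"
    then have "z k = z (k + 1)" using zg k by (force simp: closed_grids_def)
    then obtain i where i: "1 \<le> i" "i + 1 < N" "(z i < z (i + 1)) \<noteq> (z (i + 1) < z (i + 2))"
      using adjacent_gaps[OF zg k] by blast
    have le: "z i \<le> z (i + 1)" "z (i + 1) \<le> z (i + 2)"
      using zg i by (auto simp: closed_grids_def dest: bspec[of _ _ i] bspec[of _ _ "i + 1"])
    \<comment> \<open>Moving the point between the degenerate and the proper gap to the midpoint
      makes both gaps proper.\<close>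
    define m where "m = (z i + z (i + 2)) / 2"
    have m: "z i < m" "m < z (i + 2)" using le i(3) by (auto simp: m_def)
    define w where "w = z(i + 1 := m)"
    have wg: "w \<in> closed_grids N"
      using zg m i by (auto simp: closed_grids_def w_def) (smt (verit))+
    have "cell_sum r N w \<le> cell_sum r N z"
    proof -
      define T where "T v k = cell r (n * v k) (n * v (k + 1))" for v :: "nat \<Rightarrow> real" and k
      let ?R = "{1..N-1} - {i, i + 1}"
      have split: "cell_sum r N v = T v i + (T v (i + 1) + sum (T v) ?R)" for v
      proof -
        have "{1..N-1} = insert i (insert (i + 1) ?R)" using i by auto
        then have "cell_sum r N v = sum (T v) (insert i (insert (i + 1) ?R))"
          by (simp add: cell_sum_def T_def n_def)
        then show ?thesis by simp
      qed
      have "sum (T w) ?R = sum (T z) ?R"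
        by (intro sum.cong) (auto simp: T_def w_def)
      moreover have "T w i + T w (i + 1) \<le> cell r (n * z i) (n * z (i + 2))"
        using cell_split[OF r, of "n * z i" "n * m" "n * z (i + 2)"] m n by (simp add: T_def w_def)
      \<comment> \<open>One of the two gaps is degenerate and its cell is zero, so the other cell
        spans the whole of both.\<close>
      moreover have "T z i + T z (i + 1) = cell r (n * z i) (n * z (i + 2))"
        using le i(3) by (cases "z i = z (i + 1)") (auto simp: T_def)
      ultimately show ?thesis by (simp add: split)
    qed
    then have "P w" using wg z(1) unfolding P_def by (meson order_trans)
    moreover have "gaps z \<subset> gaps w"
    proof -
      have "gaps z \<subseteq> gaps w"
        using m le by (auto simp: gaps_def w_def)
      moreover have "{i, i + 1} \<subseteq> gaps w" using i m by (auto simp: gaps_def w_def)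
      moreover have "\<not> {i, i + 1} \<subseteq> gaps z" using i by (auto simp: gaps_def)
      ultimately show ?thesis by blast
    qed
    then have "card (gaps z) < card (gaps w)"
      by (intro psubset_card_mono) (simp_all add: gaps_def)
    ultimately show False using z(2)[of w] by simp
  qed
  then show ?thesis using z(1) unfolding P_def by blast
qed

section \<open>The distortion through cells, and critical points\<close>

lemma distortion_eq:
  assumes "x \<in> simplex01 N" "N \<ge> 2"
  shows "distortion r N (mu r N) x
    = norm_const r * (real N - 1) powr - (r + 1) * cell_sum r N (with_endpoints N x)"
  unfolding distortion_def cell_sum_def sum_distrib_left Let_def
proof (intro sum.cong refl)
  fix i assume "i \<in> {1..N-1}"
  then show "(LINT \<xi>:{with_endpoints N x i<..<with_endpoints N x (i + 1)}|mu r N.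
        (\<xi> - with_endpoints N x i) powr r *
        ((with_endpoints N x (i + 1) - \<xi>) / (with_endpoints N x (i + 1) - with_endpoints N x i)) +
        (with_endpoints N x (i + 1) - \<xi>) powr r *
        ((\<xi> - with_endpoints N x i) / (with_endpoints N x (i + 1) - with_endpoints N x i)))
    = norm_const r * (real N - 1) powr - (r + 1) *
        cell r ((real N - 1) * with_endpoints N x i) ((real N - 1) * with_endpoints N x (i + 1))"
    using assms by (intro distortion_term[OF r] with_endpoints_less with_endpoints_bounds) auto
qed

lemma distortion_le_iff:
  assumes "x \<in> simplex01 N" "y \<in> simplex01 N" "N \<ge> 2"
  shows "distortion r N (mu r N) x \<le> distortion r N (mu r N) y
    \<longleftrightarrow> cell_sum r N (with_endpoints N x) \<le> cell_sum r N (with_endpoints N y)"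
  using assms norm_const_pos[OF r] by (simp add: distortion_eq mult.assoc)

text \<open>Point \<open>k\<close> is the left end of cell \<open>k\<close> and the right end of
  cell \<open>k - 1\<close>, whence the two contributions \<open>A k\<close> and
  \<open>B (k - 1)\<close>.\<close>

lemma has_gradient_distortion:
  assumes x: "x \<in> simplex01 N" and N: "N \<ge> 2"
    and der: "\<And>i. 1 \<le> i \<Longrightarrow> i < N \<Longrightarrow> ((\<lambda>z. cell r (fst z) (snd z)) has_derivative
      (\<lambda>d. A i * fst d + B i * snd d))
      (at ((real N - 1) * with_endpoints N x i, (real N - 1) * with_endpoints N x (i + 1)))"
  shows "has_gradient N (distortion r N (mu r N))
    (\<lambda>k. norm_const r * (real N - 1) powr - (r + 1) * ((real N - 1) * (A k + B (k - 1)))) x"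
proof (rule has_gradient_cong)
  let ?n = "real N - 1"
  show "has_gradient N (\<lambda>y. norm_const r * ?n powr - (r + 1) * cell_sum r N (with_endpoints N y))
     (\<lambda>k. norm_const r * ?n powr - (r + 1) *
       (\<Sum>i=1..N-1. (if k = i then ?n * A i else 0) + (if k = i + 1 then ?n * B i else 0))) x"
    unfolding cell_sum_def
  proof (intro has_gradient_cmult has_gradient_sum)
    fix i assume "i \<in> {1..N-1}"
    then have i: "1 \<le> i" "i < N" using N by auto
    show "has_gradient N (\<lambda>y. cell r (?n * with_endpoints N y i) (?n * with_endpoints N y (i + 1)))
        (\<lambda>k. (if k = i then ?n * A i else 0) + (if k = i + 1 then ?n * B i else 0)) x"
      using has_gradient_two_coordinates[OF i _ der[OF i]] N by simp
  qed simp
  show "norm_const r * ?n powr - (r + 1) * (?n * (A k + B (k - 1))) =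
      norm_const r * ?n powr - (r + 1) *
       (\<Sum>i=1..N-1. (if k = i then ?n * A i else 0) + (if k = i + 1 then ?n * B i else 0))"
    if k: "k \<in> {2..N-1}" for k
  proof -
    have "(\<Sum>i=1..N-1. if k = i then ?n * A i else 0) = ?n * A k"
      using k by (simp add: sum.delta')
    moreover have "(\<Sum>i=1..N-1. if k = i + 1 then ?n * B i else 0) = ?n * B (k - 1)"
    proof -
      have "(\<Sum>i=1..N-1. if k = i + 1 then ?n * B i else 0) = (\<Sum>i=1..N-1. if k - 1 = i then ?n * B i else 0)"
        using k by (intro sum.cong) auto
      also have "\<dots> = ?n * B (k - 1)" using k by (subst sum.delta') auto
      finally show ?thesis .
    qed
    ultimately show ?thesis by (simp add: sum.distrib distrib_left)
  qed
qed (use assms in \<open>auto simp: distortion_eq\<close>)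

text \<open>In the open simplex all cells are proper, so a gradient exists; at the minimum each of
  its coordinates vanishes.\<close>

lemma critical_point_of_minimum:
  assumes x: "x \<in> simplex01 N" and N: "N \<ge> 2"
    and min: "\<And>y. y \<in> simplex01 N \<Longrightarrow> distortion r N (mu r N) x \<le> distortion r N (mu r N) y"
  shows "critical_point N (distortion r N (mu r N)) x"
proof -
  define Q where "Q i A B \<longleftrightarrow> ((\<lambda>z. cell r (fst z) (snd z)) has_derivative (\<lambda>d. A * fst d + B * snd d))
      (at ((real N - 1) * with_endpoints N x i, (real N - 1) * with_endpoints N x (i + 1)))" for i A B
  have "\<exists>A B. Q i A B" if "1 \<le> i" "i < N" for i
    unfolding Q_def using with_endpoints_less[OF x that] N
    by (intro cell_has_derivative[OF r] mult_strict_left_mono) auto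
  then obtain A B where AB: "\<And>i. 1 \<le> i \<Longrightarrow> i < N \<Longrightarrow> Q i (A i) (B i)"
    by metis
  note grad = has_gradient_distortion[OF x N AB[unfolded Q_def]]
  have "has_gradient N (distortion r N (mu r N)) (\<lambda>k. 0) x"
    using gradient_zero_at_minimum[OF grad x min] by (intro has_gradient_cong[OF grad _ x]) auto
  then show ?thesis using x by (simp add: critical_point_def)
qed

section \<open>The uniform grid and the second critical point\<close>

lemma xstar_in_simplex01:
  assumes "N \<ge> 2"
  shows "xstar N \<in> simplex01 N"
  unfolding xstar_def using assms by (intro restrict_in_simplex01) (auto simp: divide_strict_right_mono)

lemma with_endpoints_xstar:
  assumes "N \<ge> 2" "i \<in> {1..N}"
  shows "(real N - 1) * with_endpoints N (xstar N) i = real i - 1"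
  unfolding xstar_def using assms by (subst with_endpoints_restrict) auto

text \<open>Every cell is an integer translate of the unit cell, with partial derivatives
  \<open>A\<close> and \<open>- A\<close>, so each coordinate of the gradient is a multiple of
  \<open>A - A\<close>.\<close>

lemma critical_point_xstar:
  assumes N: "N \<ge> 2"
  shows "critical_point N (distortion r N (mu r N)) (xstar N)"
proof -
  obtain A where A: "\<And>k::int. ((\<lambda>z. cell r (fst z) (snd z)) has_derivative (\<lambda>d. A * fst d - A * snd d))
      (at (of_int k, of_int k + 1))"
    using unit_cell_has_derivative[OF r] by blast
  have "((\<lambda>z. cell r (fst z) (snd z)) has_derivative (\<lambda>d. A * fst d + (- A) * snd d))
      (at ((real N - 1) * with_endpoints N (xstar N) i, (real N - 1) * with_endpoints N (xstar N) (i + 1)))"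
    if "1 \<le> i" "i < N" for i
    using A[of "int i - 1"] N that by (simp add: with_endpoints_xstar)
  from has_gradient_distortion[OF xstar_in_simplex01[OF N] N this]
  show ?thesis using xstar_in_simplex01[OF N] by (simp add: critical_point_def)
qed

text \<open>All interior points are shifted by \<open>s / (N - 1)\<close>: up to a common factor, each of the \<open>N - 3\<close>
  interior cells decreases by at least \<open>\<kappa> s\<^sup>2\<close>, while the two boundary cells together increase by
  at most \<open>K s\<^sup>2\<close>, with \<open>\<kappa>\<close> and \<open>K\<close> independent of \<open>N\<close>.\<close>

lemma eventually_not_local_minimum_xstar:
  "\<exists>N0\<ge>3. \<forall>N\<ge>N0. \<not> local_minimum N (distortion r N (mu r N)) (xstar N)"
proof -
  obtain \<kappa> s0 where \<kappa>: "\<kappa> > 0" "s0 > 0"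
    "\<And>s. 0 < s \<Longrightarrow> s < s0 \<Longrightarrow> cell r s (1 + s) \<le> cell r 0 1 - \<kappa> * s\<^sup>2"
    using cell_translate_decrease[OF r] by blast
  obtain K where K: "\<And>s. \<bar>s\<bar> \<le> 1/2 \<Longrightarrow> cell r 0 (1 + s) + cell r 0 (1 - s) - 2 * cell r 0 1 \<le> K * s\<^sup>2"
    using cell_second_difference[OF r] by blast
  \<comment> \<open>From this threshold on the total gain \<open>(N - 3) * \<kappa>\<close> exceeds
    \<open>K\<close>.\<close>
  obtain N0 :: nat where N0: "real N0 > K / \<kappa> + 3" using reals_Archimedean2 by blast
  have "\<not> local_minimum N (distortion r N (mu r N)) (xstar N)" if N: "N \<ge> 3" "N \<ge> N0" for N
  proof
    assume "local_minimum N (distortion r N (mu r N)) (xstar N)"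
    then obtain \<delta> where \<delta>: "\<delta> > 0" "\<And>y. y \<in> simplex01 N \<Longrightarrow> tuple_dist N (xstar N) y < \<delta> \<Longrightarrow>
        distortion r N (mu r N) (xstar N) \<le> distortion r N (mu r N) y"
      by (auto simp: local_minimum_def)
    define n where "n = real N - 1"
    have n: "n > 0" using N by (simp add: n_def)
    define s where "s = min (min s0 (1/2)) \<delta> / 2"
    have s: "0 < s" "s < s0" "s < 1/2" "s < \<delta>" using \<kappa>(2) \<delta>(1) by (auto simp: s_def)
    define z where "z i = (if i = 1 then 0 else if i = N then 1 else (real i - 1 + s) / n)" for i :: nat
    have nz: "n * z i = (if i = 1 then 0 else if i = N then n else real i - 1 + s)" for i
      using n by (simp add: z_def)
    have z: "z 1 = 0" "z N = 1" using N by (auto simp: z_def)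
    have step: "z i < z (i + 1)" if i: "1 \<le> i" "i < N" for i
    proof -
      have "real i + 1 \<le> real N" using i by linarith
      then have "n * z i < n * z (i + 1)" unfolding nz using i s N by (auto simp: n_def)
      then show ?thesis using n by simp
    qed
    let ?y = "restrict z {2..N-1}"
    have y: "?y \<in> simplex01 N" by (rule restrict_in_simplex01[OF z step])
    \<comment> \<open>Each of the \<open>N - 2\<close> coordinates moves by
      \<open>s / (N - 1)\<close>, so even the sum of the moves is at most \<open>s\<close>.\<close>
    have "tuple_dist N (xstar N) ?y \<le> (\<Sum>i=2..N-1. \<bar>?y i - xstar N i\<bar>)"
      unfolding tuple_dist_def by (rule L2_set_le_sum_abs)
    also have "\<dots> = (\<Sum>i=2..N-1. s / n)"
      using n s by (intro sum.cong) (auto simp: z_def xstar_def n_def diff_divide_distrib[symmetric])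
    also have "\<dots> \<le> s"
      using N n s by (simp add: n_def field_simps of_nat_diff)
    finally have "tuple_dist N (xstar N) ?y < \<delta>" using s by simp
    then have "cell_sum r N (with_endpoints N (xstar N)) \<le> cell_sum r N (with_endpoints N ?y)"
      using \<delta>(2)[OF y] y N distortion_le_iff[of "xstar N" N ?y] by (simp add: xstar_in_simplex01)
    moreover have "cell_sum r N (with_endpoints N (xstar N)) = real (N - 1) * cell r 0 1"
    proof -
      have "cell_sum r N (with_endpoints N (xstar N)) = (\<Sum>i=1..N-1. cell r 0 1)"
        unfolding cell_sum_def
      proof (intro sum.cong refl)
        fix i assume "i \<in> {1..N-1}"
        then have "i \<in> {1..N}" "i + 1 \<in> {1..N}" using N by auto
        from this[THEN with_endpoints_xstar[rotated]] have
            "(real N - 1) * with_endpoints N (xstar N) i = 0 + of_int (int i - 1)"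
            "(real N - 1) * with_endpoints N (xstar N) (i + 1) = 1 + of_int (int i - 1)"
          using N by simp_all
        then show "cell r ((real N - 1) * with_endpoints N (xstar N) i)
            ((real N - 1) * with_endpoints N (xstar N) (i + 1)) = cell r 0 1"
          using cell_shift[OF r] by metis
      qed
      then show ?thesis by simp
    qed
    moreover have "cell_sum r N (with_endpoints N ?y)
        = cell r 0 (1 + s) + cell r 0 (1 - s) + real (N - 3) * cell r s (1 + s)"
    proof -
      have "cell_sum r N (with_endpoints N ?y) = (\<Sum>i=1..N-1. cell r (n * z i) (n * z (i + 1)))"
        unfolding cell_sum_def n_def
        by (intro sum.cong refl arg_cong2[where f = "cell r"] arg_cong2[where f = "(*)"]
            with_endpoints_restrict[OF z]) auto
      \<comment> \<open>First cell, last cell and interior cells; for \<open>N = 3\<close> the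
        interior range is empty.\<close>
      also have "{1..N-1} = insert 1 (insert (N - 1) {2..N-2})" using N by auto
      also have "(\<Sum>i\<in>\<dots>. cell r (n * z i) (n * z (i + 1))) =
          cell r (n * z 1) (n * z 2) + (cell r (n * z (N - 1)) (n * z N)
            + (\<Sum>i=2..N-2. cell r (n * z i) (n * z (i + 1))))"
      proof -
        have "1 \<notin> insert (N - 1) {2..N-2}" "N - 1 \<notin> {2..N-2}" "N - 1 + 1 = N" "(1::nat) + 1 = 2"
          using N by auto
        then show ?thesis by (simp only: sum.insert finite_insert finite_atLeastAtMost not_False_eq_True)
      qed
      also have "cell r (n * z 1) (n * z 2) = cell r 0 (1 + s)"
        using N by (simp add: nz)
      also have "cell r (n * z (N - 1)) (n * z N) = cell r 0 (1 - s)"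
      proof -
        \<comment> \<open>Up to an integer shift the last cell is \<open>[- (1 - s), 0]\<close>,
          which is reflected.\<close>
        have "n * z (N - 1) = - (1 - s) + of_int (int N - 1)" "n * z N = - 0 + of_int (int N - 1)"
          unfolding nz using N by (auto simp: n_def of_nat_diff)
        then show ?thesis by (simp only: cell_shift[OF r] cell_reflect)
      qed
      also have "(\<Sum>i=2..N-2. cell r (n * z i) (n * z (i + 1))) = (\<Sum>i=2..N-2. cell r s (1 + s))"
      proof (intro sum.cong refl)
        fix i assume "i \<in> {2..N-2}"
        then have "n * z i = s + of_int (int i - 1)" "n * z (i + 1) = (1 + s) + of_int (int i - 1)"
          unfolding nz using N by auto
        then show "cell r (n * z i) (n * z (i + 1)) = cell r s (1 + s)"
          by (simp only: cell_shift[OF r])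
      qed
      also have "\<dots> = real (N - 3) * cell r s (1 + s)" using N by simp
      finally show ?thesis by (simp only: add.assoc)
    qed
    ultimately have "real (N - 1) * cell r 0 1
        \<le> cell r 0 (1 + s) + cell r 0 (1 - s) + real (N - 3) * cell r s (1 + s)" by simp
    also have "\<dots> \<le> (2 * cell r 0 1 + K * s\<^sup>2) + real (N - 3) * (cell r 0 1 - \<kappa> * s\<^sup>2)"
    proof (rule add_mono)
      show "cell r 0 (1 + s) + cell r 0 (1 - s) \<le> 2 * cell r 0 1 + K * s\<^sup>2"
        using K[of s] s by simp
      show "real (N - 3) * cell r s (1 + s) \<le> real (N - 3) * (cell r 0 1 - \<kappa> * s\<^sup>2)"
        using \<kappa>(3)[of s] s by (intro mult_left_mono) auto
    qed
    finally have "real (N - 3) * \<kappa> * s\<^sup>2 \<le> K * s\<^sup>2"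
      using N by (simp add: of_nat_diff algebra_simps)
    then have "real (N - 3) * \<kappa> \<le> K" using s by simp
    moreover have "real (N - 3) > K / \<kappa>" using N N0 by (simp add: of_nat_diff)
    ultimately show False using \<kappa>(1) by (simp add: field_simps)
  qed
  then show ?thesis by (intro exI[of _ "max 3 N0"]) auto
qed

text \<open>The minimiser over closed grids has only proper gaps, so it restricts to a point of the
  open simplex, while each point of the simplex extends to a closed grid.\<close>

lemma global_minimum:
  assumes N: "N \<ge> 2"
  shows "\<exists>x\<in>simplex01 N. \<forall>y\<in>simplex01 N. distortion r N (mu r N) x \<le> distortion r N (mu r N) y"
proof -
  obtain z where z: "z \<in> closed_grids N" "\<And>w. w \<in> closed_grids N \<Longrightarrow> cell_sum r N z \<le> cell_sum r N w"
    "\<And>i. 1 \<le> i \<Longrightarrow> i < N \<Longrightarrow> z i < z (i + 1)"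
    using cell_sum_minimum[OF N] by blast
  let ?x = "restrict z {2..N-1}"
  have z01: "z 1 = 0" "z N = 1" using z(1) by (auto simp: closed_grids_def)
  have x: "?x \<in> simplex01 N" by (rule restrict_in_simplex01[OF z01 z(3)])
  have cong: "cell_sum r N v = cell_sum r N w" if "\<And>i. i \<in> {1..N} \<Longrightarrow> v i = w i" for v w
    unfolding cell_sum_def using N that by (intro sum.cong) auto
  have "distortion r N (mu r N) ?x \<le> distortion r N (mu r N) y" if y: "y \<in> simplex01 N" for y
  proof -
    \<comment> \<open>Padded by 0 outside \<open>{1..N}\<close>, where the tuple is
      \<open>undefined\<close> and might leave the unit interval.\<close>
    let ?w = "\<lambda>i. if i \<in> {1..N} then with_endpoints N y i else 0"
    have "?w \<in> closed_grids N"
      using with_endpoints_bounds[OF y] with_endpoints_less[OF y] N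
      by (auto simp: closed_grids_def less_imp_le) (auto simp: with_endpoints_def)
    then have "cell_sum r N z \<le> cell_sum r N ?w" by (rule z(2))
    also have "cell_sum r N ?w = cell_sum r N (with_endpoints N y)" by (intro cong) auto
    also have "cell_sum r N z = cell_sum r N (with_endpoints N ?x)"
      by (rule cong) (rule with_endpoints_restrict[OF z01, symmetric])
    finally show ?thesis using distortion_le_iff[OF x y N] by simp
  qed
  then show ?thesis using x by blast
qed

end

theorem mainTheorem4:
  fixes r :: real
  assumes "r \<ge> 1"
  shows "(\<forall>N\<ge>3. prob_space (mu r N)
            \<and> continuous_on {0..1} (f_dens r N)
            \<and> (AE u in lborel. u \<in> {0..1} \<longrightarrow> f_dens r N u > 0)
            \<and> critical_point N (distortion r N (mu r N)) (xstar N))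
       \<and> (\<exists>N0\<ge>3. \<forall>N\<ge>N0. \<not> local_minimum N (distortion r N (mu r N)) (xstar N))
       \<and> (\<exists>N0\<ge>3. \<forall>N\<ge>N0. \<exists>x y. x \<noteq> y
            \<and> critical_point N (distortion r N (mu r N)) x
            \<and> critical_point N (distortion r N (mu r N)) y)"
proof (intro conjI allI impI)
  obtain N0 where N0: "N0 \<ge> 3"
    "\<And>N. N \<ge> N0 \<Longrightarrow> \<not> local_minimum N (distortion r N (mu r N)) (xstar N)"
    using eventually_not_local_minimum_xstar[OF assms] by blast
  then show "\<exists>N0\<ge>3. \<forall>N\<ge>N0. \<not> local_minimum N (distortion r N (mu r N)) (xstar N)" by blast
  show "\<exists>N0\<ge>3. \<forall>N\<ge>N0. \<exists>x y. x \<noteq> y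
      \<and> critical_point N (distortion r N (mu r N)) x \<and> critical_point N (distortion r N (mu r N)) y"
  proof (intro exI[of _ N0] conjI allI impI)
    fix N assume N: "N \<ge> N0"
    then have N2: "N \<ge> 2" using N0(1) by simp
    obtain x where x: "x \<in> simplex01 N"
      "\<And>y. y \<in> simplex01 N \<Longrightarrow> distortion r N (mu r N) x \<le> distortion r N (mu r N) y"
      using global_minimum[OF assms N2] by blast
    then have "local_minimum N (distortion r N (mu r N)) x"
      by (auto simp: local_minimum_def intro: exI[of _ 1])
    \<comment> \<open>The same threshold serves both claims: a global minimiser is a local one,
      which \<open>xstar N\<close> is not.\<close>
    then have "x \<noteq> xstar N" using N0(2)[OF N] by blast
    then show "\<exists>x y. x \<noteq> y
        \<and> critical_point N (distortion r N (mu r N)) x \<and> critical_point N (distortion r N (mu r N)) y"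
      using critical_point_of_minimum[OF assms x(1) N2 x(2)] critical_point_xstar[OF assms N2] by blast
  qed (rule N0(1))
  fix N :: nat assume N: "N \<ge> 3"
  then have N2: "N \<ge> 2" by simp
  show "prob_space (mu r N)" by (rule prob_space_mu[OF assms N2])
  show "continuous_on {0..1} (f_dens r N)" by (rule continuous_on_f_dens[OF assms])
  show "AE u in lborel. u \<in> {0..1} \<longrightarrow> f_dens r N u > 0"
    using AE_f_dens_pos[OF assms N2] by eventually_elim simp
  show "critical_point N (distortion r N (mu r N)) (xstar N)" by (rule critical_point_xstar[OF assms N2])
qed

end
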